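(* Three agents performing Algorithm PTBoundNoChirality (defined in the context) in the semi-synchronous Passive Transport (PT) model with a known upper bound $N$ on the ring size and no chirality explore the (1-interval connected) ring with $O(N^2)$ edge traversals. One agent explicitly terminates; the others either terminate or wait perpetually on a port.
   Context: Ring: the nodes $v_0,\dots,v_{n-1}$ (indices modulo $n$) form a cycle; $v_i$ is linked to $v_{i-1}$ and $v_{i+1}$ via distinctly labelled ports $q_{i-}$ and $q_{i+}$ (labels need not be globally consistent). Time proceeds in rounds; in each round at most one edge, chosen by an adversary, is missing (1-interval connected ring). Nodes are anonymous (no distinguishable identifiers). The agents know $N\ge n$. Agents: each has memory and computational power; they are anonymous (no identifiers) and all execute the same protocol. They start at arbitrary, not necessarily distinct, nodes, cannot communicate explicitly and cannot mark nodes. Each agent $a_j$ has a consistent private orientation, i.e. a function $\lambda_j$ designating each port left or right with $\lambda_j(q_{i-})=\lambda_j(q_{k-})$ for all $i,k$. Without chirality, the orientations of different agents need not agree. Round: each active agent performs Look (it sees its own position within its node, i.e. whether it is on a port and which one, and the positions of the other agents at that node), Compute (from this snapshot and its memory it determines a direction in $\{left,right,nil\}$; if $nil$ it becomes inactive; otherwise it tries to access the corresponding port if not already there), and Move. Ports are accessed in mutual exclusion: an occupied port cannot be gained, and if several agents try the same port exactly one succeeds; an agent that fails sets $moved=false$ and becomes inactive. An agent on a port after computing moves to the other endpoint if the edge is present in this round (setting $moved=true$), and otherwise stays on the port (setting $moved=false$); in either case the port is denied to other agents in that round. Two agents crossing the same edge in opposite directions in the same round might not detect each other. Semi-synchronous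 ($\mathcal{SSYNC}$): in each round an adversary activates a non-empty subset of the agents, the others being asleep (passive); every agent is activated infinitely often; an activated agent does not know whether it was active in the previous round. An agent may be asleep on a port. PT model: if an agent is sleeping on a port in round $t$ and the corresponding edge is present in round $t$, the agent is moved to the other endpoint of the edge in round $t$. Exploration is solved if within finite time every node is visited by at least one agent. An agent explicitly terminates if within finite time it enters a terminal state and no longer moves; a terminal state may be entered only after the ring has been explored. The cost is the total number of edge traversals by the agents. Procedure Explore($dir$ | $p_1:s_1$; ...; $p_k:s_k$), with $dir\in\{left,right\}$ (in the agent's own orientation), predicates $p_i$ and states $s_i$: the agent performs Look, then evaluates $p_1,\dots,p_k$ in order; as soon as some $p_i$ is satisfied the procedure exits and the agent makes a transition to state $s_i$. If no predicate is satisfied, the agent tries to move in direction $dir$ and the procedure is executed again in the next round (in which the agent is active). ExploreNoResetEsteps is the same procedure except that it does not reset $Esteps$. Variables and predicates of an agent: $Esteps$ is the number of successful moves since Explore was last called (a use on entering a state, before a new call, refers to the value of the call just exited); $Tnodes$ is the total number of nodes the agent perceived to have explored since the beginning of the protocol. "meeting": the agent meets another agent in the node. "catches": the agent is in the node and another agent is observed on a port in the moving direction of the first agent. Algorithm PTBoundNoChirality (each agent starts in state Init with $d\gets 0$; Terminate is the terminal state). Function CheckD($x$): if $d>0$, then: if $x\le d$, Terminate; else $d\gets x$. - State Init: Explore(left | $Tnodes\ge N$: Terminate; catches: Bounce). - State Bounce: CheckD($Esteps$); Explore(right | $Tnodes\ge N$: Terminate; meeting: MeetingB; catches: Reverse).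 - State Reverse: if $d=0$ then $d\gets Esteps$, else CheckD($Esteps$); Explore(left | $Tnodes\ge N$: Terminate; meeting: MeetingR; catches: Bounce). - State MeetingR: if $Esteps\le d$, Terminate; ExploreNoResetEsteps(left | $Tnodes\ge N$: Terminate; catches: Bounce). - State MeetingB: if $Esteps\le d$, Terminate; ExploreNoResetEsteps(right | $Tnodes\ge N$: Terminate; catches: Reverse).
   Formalization: "Meeting" is not tested on the snapshot that triggered the transition into the current state; otherwise, with three agents starting at one node, one that catches a blocked agent would at once "meet" the third with Esteps = 0 ≤ d = 0 and terminate before the ring is explored. *)

theory Defs
  imports "HOL-Library.Landau_Symbols" "HOL-Library.Numeral_Type"
begin

subsection \<open>The ring and the agents\<close>

text \<open>Nodes are \<open>0, \<dots>, n - 1\<close>; \<open>Minus\<close> and \<open>Plus\<close> are the ports of node \<open>v\<close> towards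
  \<open>v - 1\<close> and \<open>v + 1\<close>.  Edge \<open>i\<close> joins \<open>i\<close> and \<open>i + 1\<close>.  Port labels do not appear: an agent
  perceives a port only through its private orientation.\<close>

datatype side = Minus | Plus

datatype direction = Lft | Rgt

datatype place = InNode | OnPort side

fun neighbour :: "nat \<Rightarrow> nat \<Rightarrow> side \<Rightarrow> nat" where
  "neighbour n v Plus = (v + 1) mod n"
| "neighbour n v Minus = (v + n - 1) mod n"

fun edge_at :: "nat \<Rightarrow> nat \<Rightarrow> side \<Rightarrow> nat" where
  "edge_at n v Plus = v"
| "edge_at n v Minus = (v + n - 1) mod n"

type_synonym orientation = "nat \<Rightarrow> side \<Rightarrow> direction"

definition consistent_orientation :: "nat \<Rightarrow> orientation \<Rightarrow> bool" where
  "consistent_orientation n l \<longleftrightarrow>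
     (\<forall>i<n. l i Minus \<noteq> l i Plus) \<and> (\<forall>i<n. \<forall>k<n. l i Minus = l k Minus)"

definition port_towards :: "orientation \<Rightarrow> nat \<Rightarrow> direction \<Rightarrow> side" where
  "port_towards l v \<delta> = (if l v Minus = \<delta> then Minus else Plus)"

datatype phase = Init | Bounce | Reverse | MeetingR | MeetingB | Terminate

text \<open>\<open>offset\<close> is the net displacement (to the agent's right) from its starting node and \<open>seen\<close>
  the set of offsets visited so far: as nodes are anonymous, these are the nodes the agent
  perceives as distinct.\<close>

record memory =
  phase :: phase
  dist :: nat
  esteps :: nat
  offset :: int
  seen :: "int set"

abbreviation tnodes :: "memory \<Rightarrow> nat" where
  "tnodes m \<equiv> card (seen m)"

record agent =
  node :: nat
  place :: place
  mem :: memory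

text \<open>\<open>'a\<close> is the index type of the agents; the indices are unknown to the agents.\<close>

type_synonym 'a configuration = "'a \<Rightarrow> agent"

definition initial_agent :: "nat \<Rightarrow> agent \<Rightarrow> bool" where
  "initial_agent n a \<longleftrightarrow> node a < n \<and> place a = InNode \<and>
     mem a = \<lparr>phase = Init, dist = 0, esteps = 0, offset = 0, seen = {0}\<rparr>"


subsection \<open>Algorithm PTBoundNoChirality\<close>

definition heading :: "phase \<Rightarrow> direction option" where
  "heading s = (case s of
      Init \<Rightarrow> Some Lft
    | Bounce \<Rightarrow> Some Rgt
    | Reverse \<Rightarrow> Some Lft
    | MeetingR \<Rightarrow> Some Lft
    | MeetingB \<Rightarrow> Some Rgt
    | Terminate \<Rightarrow> None)"

definition explore_exit :: "nat \<Rightarrow> bool \<Rightarrow> (direction \<Rightarrow> bool) \<Rightarrow> memory \<Rightarrow> phase option" where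
  "explore_exit N meets catches m = (case phase m of
      Init \<Rightarrow>
        if tnodes m \<ge> N then Some Terminate
        else if catches Lft then Some Bounce else None
    | Bounce \<Rightarrow>
        if tnodes m \<ge> N then Some Terminate
        else if meets then Some MeetingB
        else if catches Rgt then Some Reverse else None
    | Reverse \<Rightarrow>
        if tnodes m \<ge> N then Some Terminate
        else if meets then Some MeetingR
        else if catches Lft then Some Bounce else None
    | MeetingR \<Rightarrow>
        if tnodes m \<ge> N then Some Terminate
        else if catches Lft then Some Bounce else None
    | MeetingB \<Rightarrow>
        if tnodes m \<ge> N then Some Terminate
        else if catches Rgt then Some Reverse else None
    | Terminate \<Rightarrow> None)"

definition check_d :: "nat \<Rightarrow> memory \<Rightarrow> memory" where
  "check_d x m =
     (if dist m > 0 then if x \<le> dist m then m\<lparr>phase := Terminate\<rparr> else m\<lparr>dist := x\<rparr> else m)"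

text \<open>The code executed on entering a state, including the reset of \<open>esteps\<close> by the new call of
  Explore; ExploreNoResetEsteps, in the two meeting states, keeps \<open>esteps\<close>.\<close>

fun enter :: "phase \<Rightarrow> memory \<Rightarrow> memory" where
  "enter Bounce m = (check_d (esteps m) (m\<lparr>phase := Bounce\<rparr>))\<lparr>esteps := 0\<rparr>"
| "enter Reverse m =
     (if dist m = 0 then m\<lparr>phase := Reverse, dist := esteps m\<rparr>
      else check_d (esteps m) (m\<lparr>phase := Reverse\<rparr>))\<lparr>esteps := 0\<rparr>"
| "enter MeetingR m = m\<lparr>phase := if esteps m \<le> dist m then Terminate else MeetingR\<rparr>"
| "enter MeetingB m = m\<lparr>phase := if esteps m \<le> dist m then Terminate else MeetingB\<rparr>"
| "enter Init m = m\<lparr>phase := Init\<rparr>"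
| "enter Terminate m = m\<lparr>phase := Terminate\<rparr>"

text \<open>Compute: a transition takes effect at once, the Explore of the new state being evaluated on
  the snapshot of the same round.  An agent that shares the node already in the snapshot that
  triggered the transition is not met anew by the new call, hence \<open>False\<close> in the recursive
  call.  (Otherwise, for three agents starting at one node, one on its left port facing the missing
  edge, one in Init catching it, and the third still in the node, the second agent would pass
  through Bounce to MeetingB with \<open>esteps = dist = 0\<close> and terminate in the first rounds.)
  The recursion can diverge only if agents occupy both ports of a node at the beginning of a round,
  which under passive transport would require two missing edges in the preceding round.\<close>

partial_function (tailrec) compute ::
  "nat \<Rightarrow> bool \<Rightarrow> (direction \<Rightarrow> bool) \<Rightarrow> memory \<Rightarrow> memory"
where
  "compute N meets catches m = (case explore_exit N meets catches m of
      None \<Rightarrow> m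
    | Some s \<Rightarrow> compute N False catches (enter s m))"


subsection \<open>Rounds\<close>

definition meeting :: "'a configuration \<Rightarrow> 'a \<Rightarrow> bool" where
  "meeting c j \<longleftrightarrow> place (c j) = InNode \<and>
     (\<exists>k. k \<noteq> j \<and> node (c k) = node (c j) \<and> place (c k) = InNode)"

definition catching :: "'a configuration \<Rightarrow> 'a \<Rightarrow> side \<Rightarrow> bool" where
  "catching c j s \<longleftrightarrow> place (c j) = InNode \<and>
     (\<exists>k. k \<noteq> j \<and> node (c k) = node (c j) \<and> place (c k) = OnPort s)"

definition decision :: "nat \<Rightarrow> ('a \<Rightarrow> orientation) \<Rightarrow> 'a configuration \<Rightarrow> 'a \<Rightarrow> memory" where
  "decision N l c j =
     compute N (meeting c j) (\<lambda>\<delta>. catching c j (port_towards (l j) (node (c j)) \<delta>)) (mem (c j))"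

definition request :: "nat \<Rightarrow> ('a \<Rightarrow> orientation) \<Rightarrow> 'a configuration \<Rightarrow> 'a \<Rightarrow> side option" where
  "request N l c j =
     map_option (port_towards (l j) (node (c j))) (heading (phase (decision N l c j)))"

definition occupied :: "'a configuration \<Rightarrow> nat \<Rightarrow> side \<Rightarrow> bool" where
  "occupied c v s \<longleftrightarrow> (\<exists>k. node (c k) = v \<and> place (c k) = OnPort s)"

definition contenders ::
  "nat \<Rightarrow> ('a \<Rightarrow> orientation) \<Rightarrow> 'a set \<Rightarrow> 'a configuration \<Rightarrow> nat \<Rightarrow> side \<Rightarrow> 'a set"
where
  "contenders N l A c v s =
     {j \<in> A. node (c j) = v \<and> place (c j) \<noteq> OnPort s \<and> request N l c j = Some s}"

text \<open>\<open>p\<close> is a possible outcome of the access to the ports, before any edge is traversed, when the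
  agents in \<open>A\<close> are active.\<close>

definition port_access ::
  "nat \<Rightarrow> ('a \<Rightarrow> orientation) \<Rightarrow> 'a set \<Rightarrow> 'a configuration \<Rightarrow> ('a \<Rightarrow> place) \<Rightarrow> bool"
where
  "port_access N l A c p \<longleftrightarrow>
     (\<forall>j. p j = place (c j) \<or> (\<exists>s. j \<in> contenders N l A c (node (c j)) s \<and> p j = OnPort s)) \<and>
     (\<forall>v s. if occupied c v s \<or> contenders N l A c v s = {}
            then \<forall>j \<in> contenders N l A c v s. p j \<noteq> OnPort s
            else \<exists>!j. j \<in> contenders N l A c v s \<and> p j = OnPort s)"

text \<open>For \<open>j \<notin> A\<close> this is passive transport.\<close>

definition traverses ::
  "nat \<Rightarrow> nat \<Rightarrow> ('a \<Rightarrow> orientation) \<Rightarrow> 'a set \<Rightarrow> nat option \<Rightarrow> 'a configuration \<Rightarrow> ('a \<Rightarrow> place)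
    \<Rightarrow> 'a \<Rightarrow> side \<Rightarrow> bool"
where
  "traverses n N l A e c p j s \<longleftrightarrow>
     p j = OnPort s \<and> (j \<in> A \<longrightarrow> request N l c j = Some s) \<and> e \<noteq> Some (edge_at n (node (c j)) s)"

text \<open>A passively transported agent later finds itself off the port on which it was left, so it
  perceives this move as well; the counters are therefore updated at every traversal.\<close>

definition record_move :: "direction \<Rightarrow> memory \<Rightarrow> memory" where
  "record_move \<delta> m =
     (let x = offset m + (case \<delta> of Lft \<Rightarrow> -1 | Rgt \<Rightarrow> 1)
      in m\<lparr>esteps := Suc (esteps m), offset := x, seen := insert x (seen m)\<rparr>)"

definition next_configuration ::
  "nat \<Rightarrow> nat \<Rightarrow> ('a \<Rightarrow> orientation) \<Rightarrow> 'a set \<Rightarrow> nat option \<Rightarrow> 'a configuration \<Rightarrow> ('a \<Rightarrow> place)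
    \<Rightarrow> 'a configuration"
where
  "next_configuration n N l A e c p j =
     (let v = node (c j);
          m = (if j \<in> A then decision N l c j else mem (c j))
      in case p j of
           InNode \<Rightarrow> \<lparr>node = v, place = InNode, mem = m\<rparr>
         | OnPort s \<Rightarrow>
             if traverses n N l A e c p j s
             then \<lparr>node = neighbour n v s, place = InNode, mem = record_move (l j v s) m\<rparr>
             else \<lparr>node = v, place = OnPort s, mem = m\<rparr>)"


subsection \<open>Executions in the semi-synchronous passive transport model\<close>

text \<open>Round \<open>t\<close> leads from \<open>config t\<close> to \<open>config (Suc t)\<close>.\<close>

record 'a execution =
  orient :: "'a \<Rightarrow> orientation"
  active :: "nat \<Rightarrow> 'a set"
  missing :: "nat \<Rightarrow> nat option"
  access :: "nat \<Rightarrow> 'a \<Rightarrow> place"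
  config :: "nat \<Rightarrow> 'a configuration"

definition pt_execution :: "nat \<Rightarrow> nat \<Rightarrow> 'a execution \<Rightarrow> bool" where
  "pt_execution n N E \<longleftrightarrow>
     (\<forall>j. consistent_orientation n (orient E j)) \<and>
     (\<forall>j. initial_agent n (config E 0 j)) \<and>
     (\<forall>t. active E t \<noteq> {}) \<and>
     (\<forall>j t. \<exists>t'\<ge>t. j \<in> active E t') \<and>
     (\<forall>t e. missing E t = Some e \<longrightarrow> e < n) \<and>
     (\<forall>t. port_access N (orient E) (active E t) (config E t) (access E t)) \<and>
     (\<forall>t. config E (Suc t) =
        next_configuration n N (orient E) (active E t) (missing E t) (config E t) (access E t))"

definition traversals :: "nat \<Rightarrow> nat \<Rightarrow> 'a execution \<Rightarrow> nat \<Rightarrow> nat" where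
  "traversals n N E T = card {(t, j). t < T \<and>
     (\<exists>s. traverses n N (orient E) (active E t) (missing E t) (config E t) (access E t) j s)}"

definition explored_by :: "nat \<Rightarrow> 'a execution \<Rightarrow> nat \<Rightarrow> bool" where
  "explored_by n E t \<longleftrightarrow> (\<forall>v<n. \<exists>s\<le>t. \<exists>j. node (config E s j) = v)"

definition solves_exploration :: "nat \<Rightarrow> 'a execution \<Rightarrow> bool" where
  "solves_exploration n E \<longleftrightarrow> (\<exists>t. explored_by n E t)"

definition terminated :: "'a execution \<Rightarrow> 'a \<Rightarrow> nat \<Rightarrow> bool" where
  "terminated E j t \<longleftrightarrow> phase (mem (config E t j)) = Terminate"

definition same_position :: "'a execution \<Rightarrow> 'a \<Rightarrow> nat \<Rightarrow> nat \<Rightarrow> bool" where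
  "same_position E j t t' \<longleftrightarrow>
     node (config E t' j) = node (config E t j) \<and> place (config E t' j) = place (config E t j)"

text \<open>\<open>t\<close> is the round in which \<open>j\<close> enters the terminal state; by then every node has been visited.\<close>

definition explicitly_terminates :: "nat \<Rightarrow> 'a execution \<Rightarrow> 'a \<Rightarrow> bool" where
  "explicitly_terminates n E j \<longleftrightarrow>
     (\<exists>t. explored_by n E t \<and> \<not> terminated E j t \<and>
          (\<forall>t'>t. terminated E j t' \<and> same_position E j t t'))"

definition waits_perpetually_on_port :: "'a execution \<Rightarrow> 'a \<Rightarrow> bool" where
  "waits_perpetually_on_port E j \<longleftrightarrow>
     (\<exists>t s. \<forall>t'\<ge>t. \<not> terminated E j t' \<and> place (config E t' j) = OnPort s \<and>
          same_position E j t t')"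

end

theory Submission
  imports Defs
begin

text \<open>
  Cost and liveness are local.  As long as an agent has \<open>dist = 0\<close> all its moves but those of one
  segment go left, and afterwards every turn increases \<open>dist < N\<close>, so an agent makes \<open>O(N\<^sup>2)\<close>
  moves.  Hence from some round on nobody moves.  An agent in a node that is then activated
  terminates, for otherwise it or a competitor would gain a free port; and an agent on a port waits
  at an end of the one edge that is missing in all further rounds, so at most two agents do.

  For safety, suppose that node \<open>x\<close> is unvisited, so that the ring is a line cut at \<open>x\<close>.  An agent
  turns round only behind an agent waiting on a port in the same direction, and this agent has to
  advance before any agent can wait at a port of another edge.  So the foremost agents of the two
  directions drift apart: every segment of an agent is longer than the preceding one, and an agent
  that meets another one at most \<open>dist\<close> steps after a turn would need a fourth agent at the fronts.
  Hence no agent terminates before the exploration is complete.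
\<close>

subsection \<open>Computations of a single agent\<close>

text \<open>The heading made total: its value in \<open>Terminate\<close> is unspecified, so facts
  that depend on it are guarded by \<open>phase m \<noteq> Terminate\<close>.\<close>

definition dir :: "memory \<Rightarrow> direction" where
  "dir m = the (heading (phase m))"

text \<open>Every state heading left reacts to a catch by Bounce and every state heading right by
  Reverse, so the heading alone selects the transition.\<close>

definition turn :: "memory \<Rightarrow> memory" where
  "turn m = enter (if dir m = Lft then Bounce else Reverse) m"

lemma heading_eq: "phase m \<noteq> Terminate \<Longrightarrow> heading (phase m) = Some (dir m)"
  by (cases "phase m") (simp_all add: heading_def dir_def)

section \<open>Closed form of the Compute step\<close>

lemma compute_halt: "explore_exit N b c m = None \<Longrightarrow> compute N b c m = m"
  by (subst compute.simps) simp

lemma compute_transition: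
  "explore_exit N b c m = Some s \<Longrightarrow> compute N b c m = compute N False c (enter s m)"
  by (subst compute.simps) simp

lemma compute_Terminate: "phase m = Terminate \<Longrightarrow> compute N b c m = m"
  by (rule compute_halt) (simp add: explore_exit_def)

lemma compute_explored:
  assumes "phase m \<noteq> Terminate" "N \<le> tnodes m"
  shows "compute N b c m = m\<lparr>phase := Terminate\<rparr>"
proof -
  have "explore_exit N b c m = Some Terminate"
    using assms by (cases "phase m") (simp_all add: explore_exit_def)
  then show ?thesis by (simp add: compute_transition compute_Terminate)
qed

lemma turn_phase:
  "phase (turn m) = Terminate \<or> phase (turn m) = (if dir m = Lft then Bounce else Reverse)"
  by (simp add: turn_def check_d_def)

lemma turn_unchanged [simp]:
  "offset (turn m) = offset m" "seen (turn m) = seen m" "esteps (turn m) = 0"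
  by (simp_all add: turn_def check_d_def)

lemma compute_catch:
  assumes "phase m \<noteq> Terminate" "tnodes m < N" "c (dir m)" "\<not> (c Lft \<and> c Rgt)"
  shows "compute N False c m = turn m"
proof -
  have "explore_exit N False c m = Some (if dir m = Lft then Bounce else Reverse)"
    using assms by (cases "phase m") (auto simp: explore_exit_def dir_def heading_def)
  then have "compute N False c m = compute N False c (turn m)"
    by (simp add: compute_transition turn_def)
  also have "explore_exit N False c (turn m) = None"
    using turn_phase[of m] assms by (cases "dir m") (auto simp: explore_exit_def)
  then have "compute N False c (turn m) = turn m" by (rule compute_halt)
  finally show ?thesis .
qed

text \<open>The effect of a meeting that does not end in termination: further meetings are ignored
  until the next turn, while heading and counters persist.\<close>

definition meets_anew :: "memory \<Rightarrow> memory" where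
  "meets_anew m = (if phase m = Bounce then m\<lparr>phase := MeetingB\<rparr>
     else if phase m = Reverse then m\<lparr>phase := MeetingR\<rparr> else m)"

lemma turn_meets_anew: "turn (meets_anew m) = turn m"
  by (cases m) (auto simp: turn_def meets_anew_def dir_def heading_def check_d_def)

lemma dir_meets_anew [simp]: "dir (meets_anew m) = dir m"
  by (simp add: meets_anew_def dir_def heading_def)

lemma meets_anew_unchanged [simp]:
  "offset (meets_anew m) = offset m" "seen (meets_anew m) = seen m"
  "esteps (meets_anew m) = esteps m" "dist (meets_anew m) = dist m"
  "phase (meets_anew m) = Terminate \<longleftrightarrow> phase m = Terminate"
  "phase (meets_anew m) = Init \<longleftrightarrow> phase m = Init"
  by (simp_all add: meets_anew_def)

text \<open>At most a meeting and then a catch have to be unfolded: the first transition clears the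
  meeting flag, and after a turn the agent faces the port that is not caught.\<close>

lemma compute_eq:
  assumes "\<not> (c Lft \<and> c Rgt)"
  shows "compute N b c m =
    (if phase m = Terminate then m
     else if N \<le> tnodes m \<or> b \<and> phase m \<in> {Bounce, Reverse} \<and> esteps m \<le> dist m
       then m\<lparr>phase := Terminate\<rparr>
     else if c (dir m) then turn m
     else if b then meets_anew m else m)"
proof (cases "phase m = Terminate \<or> N \<le> tnodes m")
  case True
  then show ?thesis by (auto simp: compute_Terminate compute_explored)
next
  case False
  then have nt: "phase m \<noteq> Terminate" and tn: "tnodes m < N" by auto
  have no_meet: "compute N False c m' = (if c (dir m') then turn m' else m')"
    if "phase m' \<noteq> Terminate" "tnodes m' < N" for m'
  proof (cases "c (dir m')")
    case True
    then show ?thesis using that assms by (simp add: compute_catch)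
  next
    case False
    then have "explore_exit N False c m' = None"
      using that by (cases "phase m'") (auto simp: explore_exit_def dir_def heading_def)
    then show ?thesis using False by (simp add: compute_halt)
  qed
  show ?thesis
  proof (cases "b \<and> phase m \<in> {Bounce, Reverse}")
    case True
    then have "explore_exit N b c m = Some (if phase m = Bounce then MeetingB else MeetingR)"
      using tn by (auto simp: explore_exit_def)
    then have "compute N b c m = compute N False c (enter (if phase m = Bounce then MeetingB else MeetingR) m)"
      by (rule compute_transition)
    also have "enter (if phase m = Bounce then MeetingB else MeetingR) m =
        (if esteps m \<le> dist m then m\<lparr>phase := Terminate\<rparr> else meets_anew m)"
      using True by (auto simp: meets_anew_def)
    finally show ?thesis
      using True nt tn no_meet[of "meets_anew m"]
      by (auto simp: compute_Terminate turn_meets_anew)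
  next
    case F: False
    have "meets_anew m = m" if b using F that by (simp add: meets_anew_def)
    moreover have "explore_exit N b c m = explore_exit N False c m"
      using F by (cases "phase m") (auto simp: explore_exit_def)
    then have "compute N b c m = compute N False c m"
      by (subst (1 2) compute.simps) simp
    ultimately show ?thesis using F nt tn no_meet[of m] by auto
  qed
qed

text \<open>Every traversal raises the potential by at least one and no computation lowers it.  While
  \<open>dist = 0\<close> all moves to the right since the start belong to the current call of Explore, so the
  potential is exactly the number of moves; afterwards \<open>dist\<close> grows with every turn.\<close>

definition potential :: "nat \<Rightarrow> memory \<Rightarrow> int" where
  "potential N m =
     (if phase m = Terminate then int (N * N + N)
      else if dist m = 0 then (if dir m = Rgt then 2 * int (esteps m) else 0) - offset m
      else int (N * (dist m + 1) + esteps m))"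

abbreviation displacement :: "direction \<Rightarrow> int" where
  "displacement \<delta> \<equiv> (case \<delta> of Lft \<Rightarrow> -1 | Rgt \<Rightarrow> 1)"

text \<open>The visited offsets form an interval of at most \<open>N\<close> nodes. The last clause
  puts the start of the current segment, \<open>esteps\<close> moves back against the heading, into
  it as well; this keeps \<open>esteps\<close> below \<open>N\<close>.\<close>

definition memory_ok :: "nat \<Rightarrow> memory \<Rightarrow> bool" where
  "memory_ok N m \<longleftrightarrow> (\<exists>a b. seen m = {a..b} \<and> a \<le> 0 \<and> 0 \<le> b \<and> b - a < int N \<and>
     offset m \<in> {a..b} \<and> dist m < N \<and> (phase m = Init \<longrightarrow> dist m = 0) \<and>
     (phase m \<noteq> Terminate \<longrightarrow> offset m - displacement (dir m) * int (esteps m) \<in> {a..b}))"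

section \<open>Bounds on the counters and growth of the potential\<close>

lemma dir_turn: "phase (turn m) \<noteq> Terminate \<Longrightarrow> dir (turn m) \<noteq> dir m"
  using turn_phase[of m] by (cases "dir m") (auto simp: dir_def heading_def)

lemma phase_turn_noninit: "phase (turn m) \<noteq> Init"
  using turn_phase[of m] by (auto split: if_splits)

lemma dist_turn:
  "phase (turn m) = Terminate \<longleftrightarrow> 0 < dist m \<and> esteps m \<le> dist m"
  "phase (turn m) \<noteq> Terminate \<Longrightarrow>
     dist (turn m) = (if dist m = 0 \<and> dir m = Lft then 0 else esteps m)"
proof -
  show "phase (turn m) = Terminate \<longleftrightarrow> 0 < dist m \<and> esteps m \<le> dist m"
    by (cases "dir m") (auto simp: turn_def check_d_def)
  show "dist (turn m) = (if dist m = 0 \<and> dir m = Lft then 0 else esteps m)"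
    if "phase (turn m) \<noteq> Terminate"
    using that by (cases "dir m") (auto simp: turn_def check_d_def split: if_splits)
qed

lemma memory_ok_esteps:
  assumes "memory_ok N m" "phase m \<noteq> Terminate"
  shows "esteps m < N"
  using assms by (cases "dir m") (auto simp: memory_ok_def)

lemma memory_ok_turn:
  assumes "memory_ok N m" "phase m \<noteq> Terminate"
  shows "memory_ok N (turn m)"
proof -
  have "esteps m < N" using assms by (rule memory_ok_esteps)
  moreover have "dist (turn m) < N"
    using calculation assms(1) by (cases "dir m") (auto simp: turn_def check_d_def memory_ok_def)
  ultimately show ?thesis
    using assms by (auto simp: memory_ok_def phase_turn_noninit)
qed

lemma memory_ok_compute:
  assumes "memory_ok N m" "\<not> (c Lft \<and> c Rgt)"
  shows "memory_ok N (compute N b c m)"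
  using assms memory_ok_turn[of N m]
  by (auto simp: compute_eq memory_ok_def)

lemma potential_le:
  assumes "memory_ok N m"
  shows "potential N m \<le> int (N * N + N)"
proof (cases "phase m = Terminate")
  case True
  then show ?thesis by (simp add: potential_def)
next
  case False
  have e: "esteps m < N" using assms False by (rule memory_ok_esteps)
  have d: "dist m < N" using assms by (auto simp: memory_ok_def)
  have "N * (dist m + 1) + esteps m \<le> N * N + N"
    using e d by (intro add_mono mult_le_mono) auto
  moreover have "(if dir m = Rgt then 2 * int (esteps m) else 0) - offset m \<le> int (N * N + N)"
  proof -
    \<comment> \<open>A segment to the right starts at \<open>offset m - int (esteps m)\<close>,
      which exceeds \<open>- int N\<close>; its length, below \<open>N\<close>, accounts for the
      second \<open>N\<close>.\<close>
    have "(if dir m = Rgt then 2 * int (esteps m) else 0) - offset m \<le> 2 * int N"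
      using assms False e by (cases "dir m") (auto simp: memory_ok_def)
    also have "int N \<le> int N * int N" by (cases N) auto
    then have "2 * int N \<le> int (N * N + N)" by simp
    finally show ?thesis .
  qed
  ultimately show ?thesis using False unfolding potential_def by (auto simp del: of_nat_add of_nat_mult)
qed

text \<open>With \<open>dist\<close> positive, a surviving turn gives up fewer than \<open>N\<close>
  steps and raises \<open>dist\<close> by at least one, which is worth \<open>N\<close>. A Reverse
  with \<open>dist\<close> zero and some steps makes the potential at least \<open>2 * N\<close>,
  which covers the old value; other surviving turns leave it unchanged.\<close>

lemma potential_turn:
  assumes "memory_ok N m" "phase m \<noteq> Terminate"
  shows "potential N m \<le> potential N (turn m)"
proof (cases "phase (turn m) = Terminate")
  case True
  then show ?thesis using potential_le[OF assms(1)] by (simp add: potential_def)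
next
  case nt: False
  have e: "esteps m < N" using assms by (rule memory_ok_esteps)
  have dn: "dir (turn m) = (if dir m = Lft then Rgt else Lft)"
    using dir_turn[OF nt] by (cases "dir m"; cases "dir (turn m)") auto
  show ?thesis
  proof (cases "dist m = 0")
    case True
    have "2 * int (esteps m) - offset m \<le> int (N * (esteps m + 1))" if "dir m = Rgt" "0 < esteps m"
    proof -
      have "2 * int (esteps m) - offset m \<le> 2 * int N"
        using assms that e by (auto simp: memory_ok_def)
      also have "\<dots> \<le> int (N * (esteps m + 1))"
        using that(2) by (cases "esteps m") (auto simp: algebra_simps)
      finally show ?thesis .
    qed
    then show ?thesis
      using True nt assms(2) dn dist_turn(2)[OF nt]
      by (cases "dir m") (auto simp: potential_def)
  next
    case False
    then have lt: "dist m < esteps m" using nt dist_turn(1)[of m] by simp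
    have "N * (dist m + 1) + esteps m \<le> N * (dist m + 2)" using e by simp
    also have "\<dots> \<le> N * (esteps m + 1)" using lt by (intro mult_le_mono) auto
    finally show ?thesis
      using False nt assms(2) dist_turn(2)[OF nt] lt
      by (auto simp: potential_def simp del: of_nat_add of_nat_mult)
  qed
qed

lemma potential_compute:
  assumes "memory_ok N m" "\<not> (c Lft \<and> c Rgt)"
  shows "potential N m \<le> potential N (compute N b c m)"
proof -
  have "potential N m \<le> potential N (m\<lparr>phase := Terminate\<rparr>)"
    using potential_le[OF assms(1)] by (simp add: potential_def)
  moreover have "potential N (meets_anew m) = potential N m" by (simp add: potential_def)
  ultimately show ?thesis
    using potential_turn[OF assms(1)] by (simp add: compute_eq[OF assms(2)])
qed

lemma record_move_sel [simp]:
  "phase (record_move \<delta> m) = phase m" "dist (record_move \<delta> m) = dist m"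
  "esteps (record_move \<delta> m) = Suc (esteps m)" "dir (record_move \<delta> m) = dir m"
  "offset (record_move \<delta> m) = offset m + displacement \<delta>"
  "seen (record_move \<delta> m) = insert (offset m + displacement \<delta>) (seen m)"
  by (simp_all add: record_move_def Let_def dir_def)

lemma potential_record_move:
  assumes "phase m \<noteq> Terminate"
  shows "potential N (record_move (dir m) m) = potential N m + 1"
  using assms by (cases "dir m") (simp_all add: potential_def)

lemma memory_ok_record_move:
  assumes "memory_ok N m" "phase m \<noteq> Terminate" "tnodes m < N"
  shows "memory_ok N (record_move (dir m) m)"
proof -
  obtain a b where ab: "seen m = {a..b}" "a \<le> 0" "0 \<le> b" "b - a < int N"
     "offset m \<in> {a..b}" "dist m < N" "phase m = Init \<longrightarrow> dist m = 0"
     "offset m - displacement (dir m) * int (esteps m) \<in> {a..b}"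
    using assms(1,2) unfolding memory_ok_def by blast
  have lt: "b - a + 1 < int N" using assms(3) ab by simp
  let ?x = "offset m + displacement (dir m)"
  let ?a = "min a ?x" and ?b = "max b ?x"
  have "insert ?x {a..b} = {?a..?b}" using ab(5) by (cases "dir m") auto
  moreover have "?b - ?a < int N" using ab(4,5) lt by (cases "dir m") auto
  moreover have "?x \<in> {?a..?b}"
    "?x - displacement (dir m) * int (Suc (esteps m)) \<in> {?a..?b}"
    using ab(8) by (cases "dir m"; auto)+
  moreover have "?a \<le> 0" "0 \<le> ?b" using ab(2,3) by simp_all
  ultimately show ?thesis
    unfolding memory_ok_def record_move_sel ab(1) using ab(6,7) by blast
qed

subsection \<open>Three agents on a line\<close>

text \<open>The invariant of the safety argument, on a line.  Agent \<open>j\<close> is at \<open>x j\<close> and heads in direction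
  \<open>s j = \<plusminus>1\<close>; \<open>w j\<close> means that it waits on a port, \<open>turned j\<close> that it has turned round at least once,
  and \<open>fresh j\<close> that a meeting could still make it terminate.  Its last turn was at
  \<open>x j - s j * e j\<close> and, if \<open>d j > 0\<close>, the turn before at \<open>x j + s j * (d j - e j)\<close>.  The first
  two clauses say that the front of the agents heading like \<open>j\<close> is strictly beyond the latter place,
  and the front of those heading the other way is beyond the former, or still waits there.\<close>

definition diverging ::
  "('a \<Rightarrow> int) \<Rightarrow> ('a \<Rightarrow> int) \<Rightarrow> ('a \<Rightarrow> bool) \<Rightarrow> ('a \<Rightarrow> nat) \<Rightarrow> ('a \<Rightarrow> nat) \<Rightarrow> ('a \<Rightarrow> bool) \<Rightarrow> ('a \<Rightarrow> bool) \<Rightarrow> bool"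
where
  "diverging x s w e d turned fresh \<longleftrightarrow>
     (\<forall>j. 0 < d j \<longrightarrow> (\<exists>i. s i = s j \<and> s j * x j + int (d j) - int (e j) < s j * x i)) \<and>
     (\<forall>j. turned j \<longrightarrow> (\<exists>i. s i = - s j \<and>
        (s j * x i < s j * x j - int (e j) \<or> s j * x i = s j * x j - int (e j) \<and> w i))) \<and>
     (\<forall>j. fresh j \<longrightarrow> \<not> w j \<longrightarrow> e j = 0 \<longrightarrow>
        (\<forall>k. k \<noteq> j \<longrightarrow> s k * x j < s k * x k \<or> x k = x j \<and> w k) \<and>
        (\<forall>k k'. k \<noteq> j \<longrightarrow> k' \<noteq> j \<longrightarrow> k \<noteq> k' \<longrightarrow> s k \<noteq> s k'))"

lemma divergingD1:
  assumes "diverging x s w e d turned fresh" "0 < d j"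
  obtains i where "s i = s j" "s j * x j + int (d j) - int (e j) < s j * x i"
  using assms unfolding diverging_def by blast

lemma divergingD2:
  assumes "diverging x s w e d turned fresh" "turned j"
  obtains i where "s i = - s j"
    "s j * x i < s j * x j - int (e j) \<or> s j * x i = s j * x j - int (e j) \<and> w i"
  using assms unfolding diverging_def by blast

lemma divergingD3:
  assumes "diverging x s w e d turned fresh" "fresh j" "\<not> w j" "e j = 0"
  shows "k \<noteq> j \<Longrightarrow> s k * x j < s k * x k \<or> x k = x j \<and> w k"
    and "k \<noteq> j \<Longrightarrow> k' \<noteq> j \<Longrightarrow> k \<noteq> k' \<Longrightarrow> s k \<noteq> s k'"
  using assms unfolding diverging_def by blast+

text \<open>This is how the number of agents enters the argument on the line.\<close>

lemma not_distinct_four: "\<not> distinct [a, b, c, d :: 3]"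
proof
  assume "distinct [a, b, c, d]"
  then have "card {a, b, c, d} = 4" by simp
  moreover have "card {a, b, c, d} \<le> CARD(3)" by (rule card_mono) auto
  ultimately show False by simp
qed

text \<open>If \<open>d j\<close> were at least \<open>e j\<close>, the first clause would give an
  agent strictly ahead of \<open>j\<close> and \<open>k\<close> with their heading, and the second
  clause one with the opposite heading: four agents.\<close>

lemma diverging_catch:
  fixes j k :: 3
  assumes D: "diverging x s w e d turned fresh" and s: "\<And>j. s j = 1 \<or> s j = -1"
    and t: "turned j" and "0 < d j" "k \<noteq> j" "s k = s j" "x k = x j"
  shows "d j < e j"
proof (rule ccontr)
  assume c: "\<not> d j < e j"
  obtain i where i: "s i = s j" "s j * x j + int (d j) - int (e j) < s j * x i"
    using divergingD1[where j = j, OF D \<open>0 < d j\<close>] by blast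
  obtain i' where i': "s i' = - s j" using divergingD2[where j = j, OF D t] by blast
  have "i \<noteq> j" "i \<noteq> k" using i c assms(7) by auto
  moreover have "i' \<noteq> j" "i' \<noteq> k" "i' \<noteq> i" using i' s[of j] assms(6) i(1) by auto
  ultimately show False using not_distinct_four[of i j k i'] \<open>k \<noteq> j\<close> by auto
qed

text \<open>As for a catch, but \<open>k\<close> may have either heading, so it must also be told
  apart from the agent at or behind the last turn of \<open>j\<close>; this works because
  \<open>e j\<close> is positive.\<close>

lemma diverging_meet:
  fixes j k :: 3
  assumes D: "diverging x s w e d turned fresh" and s: "\<And>j. s j = 1 \<or> s j = -1"
    and t: "turned j" "fresh j" and "k \<noteq> j" "\<not> w j" "\<not> w k" "x k = x j"
  shows "d j < e j"
proof (rule ccontr)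
  assume c: "\<not> d j < e j"
  \<comment> \<open>Before the first step after a turn, the third clause has every other agent
    strictly past \<open>j\<close> in its own heading or waiting, so nobody inside the node can be
    met.\<close>
  have e0: "0 < e j" using divergingD3(1)[OF D t(2) \<open>\<not> w j\<close>, of k] assms(5-8) by auto
  then have d0: "0 < d j" using c by simp
  obtain i where i: "s i = s j" "s j * x j + int (d j) - int (e j) < s j * x i"
    using divergingD1[where j = j, OF D d0] by blast
  obtain i' where i'_cases: "s i' = - s j"
      "s j * x i' < s j * x j - int (e j) \<or> s j * x i' = s j * x j - int (e j) \<and> w i'"
    using divergingD2[where j = j, OF D t(1)] by blast
  then have i': "s i' = - s j" "s j * x i' \<le> s j * x j - int (e j)" by auto
  have "i \<noteq> j" "i \<noteq> k" using i(2) c assms(8) by auto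
  moreover have "i' \<noteq> j" using i'(1) s[of j] by auto
  moreover have "i' \<noteq> k" using i'(2) assms(8) e0 by auto
  moreover have "i' \<noteq> i" using i'(1) s[of j] i(1) by auto
  ultimately show False using not_distinct_four[of i j k i'] \<open>k \<noteq> j\<close> by auto
qed

text \<open>One round: \<open>T\<close> is the set of agents that turn round, \<open>M\<close> the set of those that traverse an
  edge.  A turn is caused by an agent waiting at the same place; that agent cannot turn itself, so
  it keeps the front of its direction.\<close>

lemma diverging_round:
  fixes x s x' s' :: "3 \<Rightarrow> int" and T M :: "3 set"
  assumes D: "diverging x s w e d turned fresh" and s: "\<And>j. s j = 1 \<or> s j = -1"
    and turn: "\<And>j. j \<in> T \<Longrightarrow> \<not> w j \<and> s' j = - s j \<and> (d' j = 0 \<or> turned j \<and> d' j = e j) \<and>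
      (\<exists>k. k \<noteq> j \<and> x k = x j \<and> s k = s j \<and> w k)"
    and go: "\<And>j. j \<notin> T \<Longrightarrow> s' j = s j \<and> d' j = d j \<and> (turned' j \<longrightarrow> turned j) \<and> (fresh' j \<longrightarrow> fresh j)"
    and move: "\<And>j. j \<in> M \<Longrightarrow> x' j = x j + s' j \<and> e' j = Suc (if j \<in> T then 0 else e j) \<and> \<not> w' j"
    and stay: "\<And>j. j \<notin> M \<Longrightarrow> x' j = x j \<and> e' j = (if j \<in> T then 0 else e j) \<and> (w j \<longrightarrow> w' j)"
    and edge: "\<And>i j. w i \<Longrightarrow> w j \<Longrightarrow> s i = 1 \<Longrightarrow> s j = -1 \<Longrightarrow> x j = x i + 1"
    and contest: "\<And>j. j \<in> T \<Longrightarrow> j \<notin> M \<Longrightarrow> \<not> w' j \<Longrightarrow>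
      \<exists>k. k \<noteq> j \<and> x k = x j \<and> \<not> w k \<and> s' k = s' j \<and> (k \<in> M \<or> w' k)"
  shows "diverging x' s' w' e' d' turned' fresh'"
proof -
  have wT: "i \<notin> T" if "w i" for i using that turn by blast
  have s': "s' j = 1 \<or> s' j = -1" for j
    using s[of j] turn[of j] go[of j] by (cases "j \<in> T") auto
  \<comment> \<open>Along the heading this is the place of the last turn: a move changes both terms
    alike, and only a turn resets it, to the current place.\<close>
  have start: "s' j * x' j - int (e' j) = s' j * x j - int (if j \<in> T then 0 else e j)" for j
    using s'[of j] move[of j] stay[of j] by (cases "j \<in> M") auto
  have fwd: "s' j * x j \<le> s' j * x' j" for j
    using s'[of j] move[of j] stay[of j] by (cases "j \<in> M") auto
  have waiting: "s' i = s i \<and> (s i * x i < s i * x' i \<or> x' i = x i \<and> w' i)" if "w i" for i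
    using s[of i] move[of i] stay[of i] go[of i] wT[OF that] that by (cases "i \<in> M") auto
  \<comment> \<open>The front of an old heading never recedes: an agent that turns is replaced by
    the waiting agent it caught.\<close>
  have front: "\<exists>i'. s' i' = s i \<and> s i * x i \<le> s i * x' i'" for i
  proof (cases "i \<in> T")
    case True
    then obtain k where "x k = x i" "s k = s i" "w k" using turn by blast
    then show ?thesis using waiting[of k] by (intro exI[of _ k]) auto
  next
    case False
    then show ?thesis using go[of i] fwd[of i] by (intro exI[of _ i]) auto
  qed
  show ?thesis
    unfolding diverging_def
  proof (intro conjI allI impI)
    fix j assume d': "0 < d' j"
    show "\<exists>i. s' i = s' j \<and> s' j * x' j + int (d' j) - int (e' j) < s' j * x' i"
    proof (cases "j \<in> T")
      case True
      then obtain k where k: "k \<noteq> j" "x k = x j" "s k = s j" "w k" and tj: "turned j" "d' j = e j"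
        and sj: "s' j = - s j"
        using turn[OF True] d' by auto
      obtain i where i: "s i = - s j"
        "s j * x i < s j * x j - int (e j) \<or> s j * x i = s j * x j - int (e j) \<and> w i"
        using divergingD2[where j = j, OF D tj(1)] by blast
      \<comment> \<open>If \<open>i\<close> waited, it and \<open>k\<close> would face each other
        across one edge, putting \<open>i\<close> one step ahead of \<open>j\<close>; but
        \<open>i\<close> lies at or behind the last turn of \<open>j\<close>. So the inequality is
        strict, as the first clause for the new segment requires.\<close>
      have "\<not> w i"
      proof
        assume "w i"
        then have "s j * x i = s j * x j + 1"
          using edge[of k i] edge[of i k] k i(1) s[of j] by auto
        then show False using i(2) by auto
      qed
      then have lt: "s i * x i > s i * x j + int (e j)" using i by auto
      obtain i' where "s' i' = s i" "s i * x i \<le> s i * x' i'" using front by blast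
      then show ?thesis
        using lt start[of j] True sj tj i(1) by (intro exI[of _ i']) auto
    next
      case False
      then have j: "s' j = s j" "0 < d j" "d' j = d j" using go[of j] d' by auto
      obtain i where i: "s i = s j" "s j * x j + int (d j) - int (e j) < s j * x i"
        using divergingD1[where j = j, OF D j(2)] by blast
      obtain i' where "s' i' = s i" "s i * x i \<le> s i * x' i'" using front by blast
      then show ?thesis using i j False start[of j] by (intro exI[of _ i']) auto
    qed
  next
    fix j assume t': "turned' j"
    show "\<exists>i. s' i = - s' j \<and> (s' j * x' i < s' j * x' j - int (e' j) \<or>
            s' j * x' i = s' j * x' j - int (e' j) \<and> w' i)"
    proof (cases "j \<in> T")
      case True
      then obtain k where k: "k \<noteq> j" "x k = x j" "s k = s j" "w k" and sj: "s' j = - s j"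
        using turn[OF True] by auto
      \<comment> \<open>The caught agent is the witness: it still waits at the place of the turn or
        has moved past it.\<close>
      then show ?thesis
        using waiting[of k] start[of j] True by (intro exI[of _ k]) auto
    next
      case False
      then have j: "s' j = s j" "turned j" using go[of j] t' by auto
      obtain i where i: "s i = - s j"
        "s j * x i < s j * x j - int (e j) \<or> s j * x i = s j * x j - int (e j) \<and> w i"
        using divergingD2[where j = j, OF D j(2)] by blast
      show ?thesis
      proof (cases "w i")
        case True
        then show ?thesis
          using waiting[of i] start[of j] False i j by (intro exI[of _ i]) auto
      next
        case nw: False
        obtain i' where "s' i' = s i" "s i * x i \<le> s i * x' i'" using front by blast
        then show ?thesis
          using nw start[of j] False i j by (intro exI[of _ i']) auto
      qed
    qed
  next
    fix j assume f': "fresh' j" and nw': "\<not> w' j" and e': "e' j = 0"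
    have nM: "j \<notin> M" using move[of j] e' by auto
    then have xj: "x' j = x j" and nw: "\<not> w j" using stay[of j] nw' by auto
    have *: "(\<forall>k. k \<noteq> j \<longrightarrow> s' k * x' j < s' k * x' k \<or> x' k = x' j \<and> w' k) \<and>
        (\<forall>k k'. k \<noteq> j \<longrightarrow> k' \<noteq> j \<longrightarrow> k \<noteq> k' \<longrightarrow> s' k \<noteq> s' k')"
    proof (cases "j \<in> T")
      case True
      then obtain k where k: "k \<noteq> j" "x k = x j" "s k = s j" "w k" and sj: "s' j = - s j"
        using turn[OF True] by auto
      \<comment> \<open>Having turned without getting a port, \<open>j\<close> lost it to some
        \<open>h\<close>. Then \<open>k\<close> and \<open>h\<close> are the two other agents, with
        opposite headings, each past \<open>j\<close> or waiting beside it.\<close>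
      obtain h where h: "h \<noteq> j" "x h = x j" "\<not> w h" "s' h = s' j" "h \<in> M \<or> w' h"
        using contest[OF True nM nw'] by blast
      have sk: "s' k = s k" using waiting[OF k(4)] by simp
      have "h \<noteq> k" using h(3) k(4) by blast
      then have others: "i = k \<or> i = h" if "i \<noteq> j" for i
        using not_distinct_four[of i j k h] that k(1) h(1) by auto
      have "s' k * x' j < s' k * x' k \<or> x' k = x' j \<and> w' k"
        using waiting[OF k(4)] xj k(2) by auto
      moreover have "s' h * x' j < s' h * x' h \<or> x' h = x' j \<and> w' h"
        using h(5) move[of h] stay[of h] s'[of h] xj h(2) by (cases "h \<in> M") auto
      moreover have "s' k \<noteq> s' h" using sk k(3) h(4) sj s[of j] by auto
      ultimately show ?thesis using others by (intro conjI allI impI) (blast, metis)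
    next
      case False
      then have f: "fresh j" and e: "e j = 0" using go[of j] stay[OF nM] f' e' by auto
      note old = divergingD3[OF D f nw e]
      \<comment> \<open>A turn needs a waiting agent with the same heading, but the two agents other
        than \<open>j\<close> head in opposite ways and \<open>j\<close> does not wait.\<close>
      have nT: "k \<notin> T" if "k \<noteq> j" for k
      proof
        assume "k \<in> T"
        then obtain k' where "k' \<noteq> k" "s k' = s k" "w k'" using turn by blast
        then show False using old(2)[of k k'] that nw by auto
      qed
      have "s' k * x' j < s' k * x' k \<or> x' k = x' j \<and> w' k" if "k \<noteq> j" for k
      proof (cases "w k")
        case True
        then show ?thesis using old(1)[OF that] waiting[OF True] xj by auto
      next
        case False
        then show ?thesis using old(1)[OF that] fwd[of k] go[OF nT[OF that]] xj by auto
      qed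
      moreover have "s' k \<noteq> s' k'" if "k \<noteq> j" "k' \<noteq> j" "k \<noteq> k'" for k k'
        using old(2)[OF that] go[OF nT[OF that(1)]] go[OF nT[OF that(2)]] by simp
      ultimately show ?thesis by blast
    qed
    show "s' k * x' j < s' k * x' k \<or> x' k = x' j \<and> w' k" if "k \<noteq> j" for k
      using * that by blast
    show "s' k \<noteq> s' k'" if "k \<noteq> j" "k' \<noteq> j" "k \<noteq> k'" for k k' using * that by blast
  qed
qed

subsection \<open>One round\<close>

text \<open>A consistent orientation gives a direction the same side at all nodes, so it can be read
  off at node 0.\<close>

definition side_of :: "orientation \<Rightarrow> direction \<Rightarrow> side" where
  "side_of l \<delta> = (if l 0 Plus = \<delta> then Plus else Minus)"

lemma consistent_orientation_side_of:
  assumes "consistent_orientation n l" "v < n"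
  shows "port_towards l v \<delta> = side_of l \<delta>" "l v (side_of l \<delta>) = \<delta>"
proof -
  have l: "l v Minus \<noteq> l v Plus" "l 0 Minus \<noteq> l 0 Plus" "l v Minus = l 0 Minus"
    using assms order.strict_trans1[OF le0 assms(2)] unfolding consistent_orientation_def by blast+
  have two: "a = \<delta> \<or> b = \<delta>" if "a \<noteq> b" for a b :: direction
    using that by (cases a; cases b; cases \<delta>) simp_all
  have "l v Plus = l 0 Plus"
    using l by (metis direction.exhaust)
  then show "port_towards l v \<delta> = side_of l \<delta>" "l v (side_of l \<delta>) = \<delta>"
    using l(1,3) two[OF l(1)] by (auto simp: port_towards_def side_of_def)
qed

lemma side_of_inject:
  assumes "consistent_orientation n l" "0 < n"
  shows "side_of l \<delta> = side_of l \<delta>' \<longleftrightarrow> \<delta> = \<delta>'"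
  using consistent_orientation_side_of(2)[OF assms] by metis

lemma edge_at_inject: "2 \<le> n \<Longrightarrow> v < n \<Longrightarrow> edge_at n v s = edge_at n v s' \<Longrightarrow> s = s'"
proof -
  assume "2 \<le> n" "v < n" "edge_at n v s = edge_at n v s'"
  moreover have "(v + n - 1) mod n \<noteq> v"
  proof (cases v)
    case 0
    then show ?thesis using \<open>2 \<le> n\<close> by simp
  next
    case (Suc u)
    then show ?thesis using \<open>v < n\<close> by simp
  qed
  ultimately show ?thesis by (cases s; cases s') auto
qed

lemma edge_at_inject_node:
  assumes "v < n" "u < n" "edge_at n v s = edge_at n u s"
  shows "v = u"
proof (cases s)
  case Minus
  have "(w + n - 1) mod n = (if w = 0 then n - 1 else w - 1)" if "w < n" for w
    using that by (cases w) auto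
  then show ?thesis using assms Minus by (auto split: if_splits)
qed (use assms in simp)

lemma neighbour_less: "0 < n \<Longrightarrow> neighbour n v s < n"
  by (cases s) auto

text \<open>Under passive transport an agent still on a port was held there by the edge missing in
  the preceding round, so all waiting agents are at the ends of a single edge
  \<open>f\<close>.\<close>

definition ports_ok :: "nat \<Rightarrow> nat \<Rightarrow> ('a \<Rightarrow> orientation) \<Rightarrow> 'a configuration \<Rightarrow> bool" where
  "ports_ok n N l c \<longleftrightarrow>
     (\<forall>j. node (c j) < n) \<and>
     (\<forall>j s. place (c j) = OnPort s \<longrightarrow> phase (mem (c j)) \<noteq> Terminate \<and>
        tnodes (mem (c j)) < N \<and> s = side_of (l j) (dir (mem (c j)))) \<and>
     (\<exists>f. \<forall>j s. place (c j) = OnPort s \<longrightarrow> edge_at n (node (c j)) s = f) \<and>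
     (\<forall>j k s. place (c j) = OnPort s \<longrightarrow> place (c k) = OnPort s \<longrightarrow> node (c j) = node (c k) \<longrightarrow> j = k)"

locale pt_round =
  fixes n N :: nat and l :: "'a \<Rightarrow> orientation" and A :: "'a set" and e :: "nat option"
    and c :: "'a configuration" and p :: "'a \<Rightarrow> place"
  assumes n: "2 \<le> n"
    and orientations: "consistent_orientation n (l j)"
    and ports: "ports_ok n N l c"
    and access: "port_access N l A c p"
begin

abbreviation "next_conf \<equiv> next_configuration n N l A e c p"

abbreviation "moves j \<equiv> \<exists>s. traverses n N l A e c p j s"

definition computed :: "'a \<Rightarrow> memory" where
  "computed j = (if j \<in> A then decision N l c j else mem (c j))"

lemma node_less: "node (c j) < n"
  using ports by (simp add: ports_ok_def)

lemma port_towards_side_of [simp]: "port_towards (l j) (node (c j)) \<delta> = side_of (l j) \<delta>"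
  using consistent_orientation_side_of(1)[OF orientations node_less] .

lemma on_portD:
  assumes "place (c j) = OnPort s"
  shows "phase (mem (c j)) \<noteq> Terminate" "tnodes (mem (c j)) < N" "s = side_of (l j) (dir (mem (c j)))"
  using ports assms by (auto simp: ports_ok_def)

lemma one_edge:
  assumes "place (c j) = OnPort s" "place (c k) = OnPort s'"
  shows "edge_at n (node (c j)) s = edge_at n (node (c k)) s'"
  using ports assms unfolding ports_ok_def by metis

text \<open>Occupied ports on both sides of a node would belong to two different edges. This
  supplies the premise of \<open>compute_eq\<close>.\<close>

lemma catching_side:
  assumes "catching c j s" "catching c j s'"
  shows "s = s'"
proof -
  obtain k k' where "node (c k) = node (c j)" "place (c k) = OnPort s"
    "node (c k') = node (c j)" "place (c k') = OnPort s'"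
    using assms by (auto simp: catching_def)
  then show ?thesis using one_edge[of k s k' s'] edge_at_inject[OF n node_less[of j], of s s'] by simp
qed

lemma side_of_eq: "side_of (l j) \<delta> = side_of (l j) \<delta>' \<longleftrightarrow> \<delta> = \<delta>'"
  using side_of_inject[OF orientations] n by simp

lemma decision_eq:
  "decision N l c j =
    (let m = mem (c j); b = meeting c j in
     if phase m = Terminate then m
     else if N \<le> tnodes m \<or> b \<and> phase m \<in> {Bounce, Reverse} \<and> esteps m \<le> dist m
       then m\<lparr>phase := Terminate\<rparr>
     else if catching c j (side_of (l j) (dir m)) then turn m
     else if b then meets_anew m else m)"
proof -
  have "\<not> (catching c j (side_of (l j) Lft) \<and> catching c j (side_of (l j) Rgt))"
    using catching_side[of j "side_of (l j) Lft" "side_of (l j) Rgt"] side_of_eq[of j Lft Rgt] by auto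
  then show ?thesis unfolding decision_def Let_def port_towards_side_of by (rule compute_eq)
qed

text \<open>Meeting and catching presuppose a position inside the node, and \<open>ports_ok\<close>
  rules out termination by the node count.\<close>

lemma decision_on_port:
  assumes "place (c j) = OnPort s"
  shows "decision N l c j = mem (c j)"
  using on_portD[OF assms] assms by (simp add: decision_eq meeting_def catching_def Let_def)

lemma computed_on_port: "place (c j) = OnPort s \<Longrightarrow> computed j = mem (c j)"
  by (simp add: computed_def decision_on_port)

lemma seen_decision: "seen (decision N l c j) = seen (mem (c j))"
  by (simp add: decision_eq Let_def)

lemma tnodes_decision: "phase (decision N l c j) \<noteq> Terminate \<Longrightarrow> tnodes (mem (c j)) < N"
  by (auto simp: decision_eq Let_def split: if_splits)

text \<open>After a turn the agent faces the other side, and only one side can be caught. Hence the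
  port it asks for is free.\<close>

lemma decision_not_catching:
  assumes "phase (decision N l c j) \<noteq> Terminate"
  shows "\<not> catching c j (side_of (l j) (dir (decision N l c j)))"
proof (cases "catching c j (side_of (l j) (dir (mem (c j))))")
  case True
  then have "decision N l c j = turn (mem (c j))"
    using assms by (auto simp: decision_eq Let_def split: if_splits)
  then show ?thesis
    using assms dir_turn[of "mem (c j)"] catching_side[OF True] side_of_eq by metis
next
  case False
  then have "dir (decision N l c j) = dir (mem (c j))"
    using assms by (auto simp: decision_eq Let_def split: if_splits)
  then show ?thesis using False by simp
qed

lemma request_eq:
  "request N l c j = (if phase (decision N l c j) = Terminate then None
     else Some (side_of (l j) (dir (decision N l c j))))"
  by (simp add: request_def heading_eq) (simp add: heading_def)

lemma access_cases:
  obtains "p j = place (c j)"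
  | "place (c j) = InNode" "j \<in> A" "phase (decision N l c j) \<noteq> Terminate"
    "p j = OnPort (side_of (l j) (dir (decision N l c j)))"
proof (cases "p j = place (c j)")
  case False
  then obtain s where s: "j \<in> contenders N l A c (node (c j)) s" "p j = OnPort s"
    using access unfolding port_access_def by blast
  then have r: "j \<in> A" "place (c j) \<noteq> OnPort s" "request N l c j = Some s"
    by (auto simp: contenders_def)
  then have d: "phase (decision N l c j) \<noteq> Terminate" "s = side_of (l j) (dir (decision N l c j))"
    by (auto simp: request_eq split: if_splits)
  have "place (c j) = InNode"
  proof (cases "place (c j)")
    case (OnPort s')
    then show ?thesis using on_portD(3)[OF OnPort] decision_on_port[OF OnPort] d(2) r(2) by simp
  qed
  then show ?thesis using that(2) r(1) d s(2) by blast
qed (use that in blast)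

text \<open>Mutual exclusion grants the free port to some contender, not necessarily to
  \<open>j\<close>. Both quiescence and the lost contest after a turn rest on this.\<close>

lemma port_gained:
  assumes "j \<in> A" "place (c j) = InNode" "phase (decision N l c j) \<noteq> Terminate"
  defines "s \<equiv> side_of (l j) (dir (decision N l c j))"
  obtains k where "k \<in> A" "node (c k) = node (c j)" "place (c k) = InNode" "p k = OnPort s"
    "phase (decision N l c k) \<noteq> Terminate" "side_of (l k) (dir (decision N l c k)) = s"
proof -
  have "\<not> occupied c (node (c j)) s"
  proof
    assume "occupied c (node (c j)) s"
    then obtain k where k: "node (c k) = node (c j)" "place (c k) = OnPort s"
      by (auto simp: occupied_def)
    then have "k \<noteq> j" using assms(2) by auto
    then show False
      using decision_not_catching[OF assms(3)] k assms(2) unfolding catching_def s_def by blast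
  qed
  moreover have j: "j \<in> contenders N l A c (node (c j)) s"
    using assms by (simp add: contenders_def request_eq)
  ultimately obtain k where k: "k \<in> contenders N l A c (node (c j)) s" "p k = OnPort s"
    using access unfolding port_access_def by (metis emptyE)
  then have "place (c k) \<noteq> p k" by (simp add: contenders_def)
  with k show ?thesis by (cases rule: access_cases[of k]) (auto simp: contenders_def that)
qed

text \<open>Passive transport makes sleeping and active agents on a port alike: only the missing
  edge holds them back.\<close>

lemma round_cases:
  obtains (stay) "p j = InNode" "place (c j) = InNode" "\<not> moves j"
      "next_conf j = \<lparr>node = node (c j), place = InNode, mem = computed j\<rparr>"
  | (wait) s where "p j = OnPort s" "s = side_of (l j) (dir (computed j))" "\<not> moves j"
      "phase (computed j) \<noteq> Terminate" "tnodes (computed j) < N" "e = Some (edge_at n (node (c j)) s)"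
      "next_conf j = \<lparr>node = node (c j), place = OnPort s, mem = computed j\<rparr>"
  | (move) s where "p j = OnPort s" "s = side_of (l j) (dir (computed j))" "moves j"
      "phase (computed j) \<noteq> Terminate" "tnodes (computed j) < N"
      "next_conf j = \<lparr>node = neighbour n (node (c j)) s, place = InNode,
         mem = record_move (dir (computed j)) (computed j)\<rparr>"
proof (cases "p j")
  case InNode
  then have "place (c j) = InNode" by (cases rule: access_cases[of j]) simp_all
  then show ?thesis
    using InNode that(1) by (auto simp: traverses_def next_configuration_def computed_def Let_def)
next
  case (OnPort s)
  have s: "s = side_of (l j) (dir (computed j)) \<and> phase (computed j) \<noteq> Terminate \<and>
    tnodes (computed j) < N"
  proof (cases rule: access_cases[of j])
    case 1
    then have "place (c j) = OnPort s" using OnPort by simp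
    then show ?thesis using on_portD[of j s] computed_on_port[of j s] by metis
  next
    case 2
    then show ?thesis
      using OnPort tnodes_decision[of j] by (simp add: computed_def seen_decision)
  qed
  then have r: "j \<in> A \<longrightarrow> request N l c j = Some s" by (auto simp: request_eq computed_def)
  have m: "l j (node (c j)) s = dir (computed j)"
    using s consistent_orientation_side_of(2)[OF orientations node_less] by simp
  show ?thesis
  proof (cases "e = Some (edge_at n (node (c j)) s)")
    case True
    then have "\<not> moves j" using OnPort by (auto simp: traverses_def)
    then show ?thesis
      using that(2)[OF OnPort] s True OnPort
      by (auto simp: next_configuration_def computed_def Let_def)
  next
    case False
    then have t: "traverses n N l A e c p j s" using OnPort r by (simp add: traverses_def)
    then have "next_conf j = \<lparr>node = neighbour n (node (c j)) s, place = InNode,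
         mem = record_move (dir (computed j)) (computed j)\<rparr>"
      using OnPort m by (simp add: next_configuration_def computed_def Let_def)
    then show ?thesis using that(3)[OF OnPort] s t by blast
  qed
qed

lemma ports_ok_next: "ports_ok n N l next_conf"
proof -
  have waiting: "p j = OnPort s \<and> s = side_of (l j) (dir (computed j)) \<and>
      phase (computed j) \<noteq> Terminate \<and> tnodes (computed j) < N \<and>
      e = Some (edge_at n (node (c j)) s) \<and> node (next_conf j) = node (c j) \<and>
      mem (next_conf j) = computed j" if "place (next_conf j) = OnPort s" for j s
    by (cases rule: round_cases[of j]) (use that in simp_all)
  have "node (next_conf j) < n" for j
    by (cases rule: round_cases[of j]) (use node_less neighbour_less n in simp_all)
  moreover have "j = k" if "place (next_conf j) = OnPort s" "place (next_conf k) = OnPort s"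
    "node (next_conf j) = node (next_conf k)" for j k s
  proof -
    have jk: "p j = OnPort s" "p k = OnPort s" "node (c j) = node (c k)"
      using waiting[OF that(1)] waiting[OF that(2)] that(3) by auto
    let ?v = "node (c k)"
    have gain: "place (c i) = OnPort s \<or> i \<in> contenders N l A c ?v s"
      if "p i = OnPort s" "node (c i) = ?v" for i
    proof (cases "p i = place (c i)")
      case False
      then obtain s' where "i \<in> contenders N l A c (node (c i)) s'" "p i = OnPort s'"
        using access unfolding port_access_def by blast
      then show ?thesis using that by simp
    qed (use that in simp)
    \<comment> \<open>Nobody gains a port that was occupied or has no contender, so both agents were
      on it already; otherwise the winner is unique.\<close>
    show ?thesis
    proof (cases "occupied c ?v s \<or> contenders N l A c ?v s = {}")
      case True
      then have "\<forall>i \<in> contenders N l A c ?v s. p i \<noteq> OnPort s"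
        using conjunct2[OF access[unfolded port_access_def], rule_format, of ?v s] by simp
      then have "place (c j) = OnPort s" "place (c k) = OnPort s" using gain jk by auto
      then show ?thesis using ports jk(3) unfolding ports_ok_def by blast
    next
      case False
      then have "\<exists>!i. i \<in> contenders N l A c ?v s \<and> p i = OnPort s"
        using conjunct2[OF access[unfolded port_access_def], rule_format, of ?v s] by simp
      moreover have "place (c j) \<noteq> OnPort s" "place (c k) \<noteq> OnPort s"
        using jk(3) False by (auto simp: occupied_def)
      then have "j \<in> contenders N l A c ?v s" "k \<in> contenders N l A c ?v s"
        using gain jk by blast+
      ultimately show ?thesis using jk by blast
    qed
  qed
  moreover have "edge_at n (node (next_conf j)) s = the e" if "place (next_conf j) = OnPort s" for j s
    using waiting[OF that] by (metis option.sel)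
  moreover have "phase (mem (next_conf j)) \<noteq> Terminate \<and> tnodes (mem (next_conf j)) < N \<and>
      s = side_of (l j) (dir (mem (next_conf j)))" if "place (next_conf j) = OnPort s" for j s
    using waiting[OF that] by metis
  ultimately show ?thesis
    unfolding ports_ok_def by blast
qed

lemma memory_ok_computed:
  assumes "memory_ok N (mem (c j))"
  shows "memory_ok N (computed j)" "potential N (mem (c j)) \<le> potential N (computed j)"
proof -
  have "\<not> (catching c j (side_of (l j) Lft) \<and> catching c j (side_of (l j) Rgt))"
    using catching_side[of j "side_of (l j) Lft" "side_of (l j) Rgt"] side_of_eq[of j Lft Rgt] by auto
  then show "memory_ok N (computed j)" "potential N (mem (c j)) \<le> potential N (computed j)"
    using assms by (simp_all add: computed_def decision_def memory_ok_compute potential_compute)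
qed

lemma memory_ok_next:
  assumes "memory_ok N (mem (c j))"
  shows "memory_ok N (mem (next_conf j))"
    "potential N (mem (c j)) + (if moves j then 1 else 0) \<le> potential N (mem (next_conf j))"
  using memory_ok_computed[OF assms]
  by (cases rule: round_cases[of j]; simp add: memory_ok_record_move potential_record_move)+

lemma terminated_next:
  assumes "phase (mem (c j)) = Terminate"
  shows "next_conf j = c j"
proof -
  have d: "computed j = mem (c j)"
    using assms by (simp add: computed_def decision_eq Let_def)
  then show ?thesis
    using assms by (cases rule: round_cases[of j]) simp_all
qed

lemma terminates_next:
  assumes "phase (mem (c j)) \<noteq> Terminate" "phase (mem (next_conf j)) = Terminate"
  shows "node (next_conf j) = node (c j)" "place (next_conf j) = place (c j)"
    "phase (decision N l c j) = Terminate"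
  using assms
  by (cases rule: round_cases[of j]; simp add: computed_def split: if_splits)+

lemma next_waiting:
  assumes "place (c j) = OnPort s" "\<not> moves j"
  shows "place (next_conf j) = OnPort s"
  using assms on_portD(3)[OF assms(1)] computed_on_port[OF assms(1)]
  by (cases rule: round_cases[of j]) simp_all

lemma next_node: "\<not> moves j \<Longrightarrow> node (next_conf j) = node (c j)"
  by (cases rule: round_cases[of j]) simp_all

text \<open>The waiting agents share one edge, the side fixes its end, and a port holds one agent.
  Hence at most two agents wait.\<close>

lemma one_agent_per_side:
  assumes "place (c j) = OnPort s" "place (c k) = OnPort s"
  shows "j = k"
proof -
  have "node (c j) = node (c k)"
    using edge_at_inject_node[OF node_less node_less one_edge[OF assms]] .
  then show ?thesis using ports assms unfolding ports_ok_def by blast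
qed

lemma card_waiting: "card {j. place (c j) \<noteq> InNode} \<le> 2"
proof -
  let ?side = "\<lambda>j. THE s. place (c j) = OnPort s"
  have side: "place (c j) = OnPort (?side j)" if "place (c j) \<noteq> InNode" for j
    using that by (cases "place (c j)") simp_all
  have "inj_on ?side {j. place (c j) \<noteq> InNode}"
  proof (rule inj_onI)
    fix j k assume jk: "j \<in> {j. place (c j) \<noteq> InNode}" "k \<in> {j. place (c j) \<noteq> InNode}"
      and eq: "?side j = ?side k"
    have "place (c j) = OnPort (?side j)" using jk(1) by (intro side) simp
    moreover have "place (c k) = OnPort (?side j)" unfolding eq using jk(2) by (intro side) simp
    ultimately show "j = k" by (rule one_agent_per_side)
  qed
  moreover have "s \<in> {Minus, Plus}" for s by (cases s) simp_all
  then have UNIV: "(UNIV :: side set) = {Minus, Plus}" by blast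
  have "finite (UNIV :: side set)" "card (UNIV :: side set) = 2"
    unfolding UNIV by simp_all
  ultimately show ?thesis
    using card_inj_on_le[of ?side "{j. place (c j) \<noteq> InNode}" UNIV] by simp
qed

end

subsection \<open>One round before the exploration is complete\<close>

text \<open>As long as node \<open>x\<close> is not visited, the ring is a path with nodes numbered from 1 to
  \<open>n - 1\<close>.\<close>

definition line_pos :: "nat \<Rightarrow> nat \<Rightarrow> nat \<Rightarrow> int" where
  "line_pos n x v = (if x \<le> v then int v - int x else int v + int n - int x)"

abbreviation side_sign :: "side \<Rightarrow> int" where
  "side_sign s \<equiv> (case s of Minus \<Rightarrow> -1 | Plus \<Rightarrow> 1)"

lemma line_pos_bounds:
  assumes "v < n" "x < n" "v \<noteq> x"
  shows "1 \<le> line_pos n x v" "line_pos n x v \<le> int n - 1"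
  using assms by (auto simp: line_pos_def)

lemma mod_succ: "v < n \<Longrightarrow> Suc v mod n = (if v + 1 = n then 0 else v + 1)" for v n :: nat
  by auto

lemma mod_pred: "v < n \<Longrightarrow> (v + n - Suc 0) mod n = (if v = 0 then n - 1 else v - 1)" for v n :: nat
  by (cases v) auto

lemma line_pos_neighbour:
  assumes "v < n" "x < n" "v \<noteq> x" "neighbour n v s \<noteq> x"
  shows "line_pos n x (neighbour n v s) = line_pos n x v + side_sign s"
  using assms
  by (cases s) (auto simp: line_pos_def mod_succ mod_pred split: if_splits)

lemma line_pos_edge:
  assumes "v < n" "u < n" "x < n" "v \<noteq> x" "u \<noteq> x" "edge_at n v Plus = edge_at n u Minus"
  shows "line_pos n x u = line_pos n x v + 1"
  using assms
  by (auto simp: line_pos_def mod_pred split: if_splits)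

definition sign :: "orientation \<Rightarrow> direction \<Rightarrow> int" where
  "sign l \<delta> = side_sign (side_of l \<delta>)"

lemma sign_cases: "sign l \<delta> = 1 \<or> sign l \<delta> = -1"
  by (cases "side_of l \<delta>") (simp_all add: sign_def)

text \<open>Offsets count to the agent's right, so \<open>sign (l j) Rgt\<close> converts them to
  line positions. No transition leads back to Init, so having left it means having turned; only
  Bounce and Reverse react to meetings, hence they are the fresh states.\<close>

definition on_line :: "nat \<Rightarrow> nat \<Rightarrow> nat \<Rightarrow> ('a \<Rightarrow> orientation) \<Rightarrow> 'a configuration \<Rightarrow> bool" where
  "on_line n N x l c \<longleftrightarrow>
     (\<forall>j. node (c j) \<noteq> x \<and> phase (mem (c j)) \<noteq> Terminate \<and> memory_ok N (mem (c j)) \<and>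
       (\<forall>i \<in> seen (mem (c j)). line_pos n x (node (c j)) + sign (l j) Rgt * (i - offset (mem (c j)))
          \<in> {1..int n - 1})) \<and>
     diverging (\<lambda>j. line_pos n x (node (c j))) (\<lambda>j. sign (l j) (dir (mem (c j))))
       (\<lambda>j. place (c j) \<noteq> InNode) (\<lambda>j. esteps (mem (c j))) (\<lambda>j. dist (mem (c j)))
       (\<lambda>j. phase (mem (c j)) \<noteq> Init) (\<lambda>j. phase (mem (c j)) \<in> {Bounce, Reverse})"

locale line_round = pt_round n N l A e c p
  for n N and l :: "3 \<Rightarrow> orientation" and A e c p +
  fixes x :: nat
  assumes x: "x < n" and N: "n \<le> N" and line: "on_line n N x l c"
begin

abbreviation "pos j \<equiv> line_pos n x (node (c j))"

abbreviation "sgn_dir j \<equiv> sign (l j) (dir (mem (c j)))"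

lemma lineD:
  "node (c j) \<noteq> x" "phase (mem (c j)) \<noteq> Terminate" "memory_ok N (mem (c j))"
  "i \<in> seen (mem (c j)) \<Longrightarrow> pos j + sign (l j) Rgt * (i - offset (mem (c j))) \<in> {1..int n - 1}"
  using line by (simp_all add: on_line_def)

lemma diverging:
  "diverging pos sgn_dir (\<lambda>j. place (c j) \<noteq> InNode) (\<lambda>j. esteps (mem (c j)))
     (\<lambda>j. dist (mem (c j))) (\<lambda>j. phase (mem (c j)) \<noteq> Init)
     (\<lambda>j. phase (mem (c j)) \<in> {Bounce, Reverse})"
  using line by (simp add: on_line_def)

lemma sign_opposite: "\<delta> \<noteq> \<delta>' \<Longrightarrow> sign (l j) \<delta> = - sign (l j) \<delta>'"
  using side_of_eq[of j \<delta> \<delta>'] by (cases "side_of (l j) \<delta>"; cases "side_of (l j) \<delta>'") (auto simp: sign_def)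

lemma sign_displacement: "sign (l j) Rgt * displacement \<delta> = sign (l j) \<delta>"
  by (cases \<delta>) (auto simp: sign_opposite[of Rgt Lft j])

text \<open>The perceived nodes inject into the \<open>n - 1\<close> positions of the line.\<close>

lemma tnodes_less: "tnodes (mem (c j)) < N"
proof -
  let ?f = "\<lambda>i. pos j + sign (l j) Rgt * (i - offset (mem (c j)))"
  have "inj_on ?f (seen (mem (c j)))"
    using sign_cases[of "l j" Rgt] by (auto intro!: inj_onI)
  then have "tnodes (mem (c j)) \<le> card {1..int n - 1}"
    using lineD(4) by (intro card_inj_on_le[where f = ?f]) auto
  then show ?thesis using n N by simp
qed

definition turning :: "3 set" where
  "turning = {j \<in> A. catching c j (side_of (l j) (dir (mem (c j))))}"

lemma caught:
  assumes "catching c j (side_of (l j) (dir (mem (c j))))"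
  obtains k where "k \<noteq> j" "pos k = pos j" "sgn_dir k = sgn_dir j" "place (c k) \<noteq> InNode"
    "place (c k) = OnPort (side_of (l j) (dir (mem (c j))))" "node (c k) = node (c j)"
proof -
  obtain k where k: "k \<noteq> j" "node (c k) = node (c j)"
    "place (c k) = OnPort (side_of (l j) (dir (mem (c j))))"
    using assms by (auto simp: catching_def)
  then have "sgn_dir k = sgn_dir j" using on_portD(3)[OF k(3)] by (simp add: sign_def)
  then show ?thesis using that k by auto
qed

text \<open>The three causes of termination are excluded in turn: a meeting by
  \<open>diverging_meet\<close>, \<open>CheckD\<close> at a catch by \<open>diverging_catch\<close>,
  the node count by \<open>tnodes_less\<close>.\<close>

lemma decision_nonterminal: "phase (decision N l c j) \<noteq> Terminate"
proof -
  let ?m = "mem (c j)"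
  have "dist ?m < esteps ?m" if "meeting c j" "phase ?m \<in> {Bounce, Reverse}"
  proof -
    obtain k where "place (c j) = InNode" "k \<noteq> j" "node (c k) = node (c j)" "place (c k) = InNode"
      using \<open>meeting c j\<close> by (auto simp: meeting_def)
    then show ?thesis
      using diverging_meet[OF diverging, of j k] sign_cases that(2) by auto
  qed
  moreover have "phase (turn ?m) \<noteq> Terminate" if catch: "catching c j (side_of (l j) (dir ?m))"
  proof -
    obtain k where k: "k \<noteq> j" "pos k = pos j" "sgn_dir k = sgn_dir j" using caught[OF catch] by blast
    have "dist ?m < esteps ?m" if "0 < dist ?m"
    proof -
      have "phase ?m \<noteq> Init" using lineD(3)[of j] that by (auto simp: memory_ok_def)
      then show ?thesis
        using diverging_catch[OF diverging, of j k] sign_cases k that by auto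
    qed
    then show ?thesis by (auto simp: dist_turn(1))
  qed
  ultimately show ?thesis
    using tnodes_less[of j] lineD(2)[of j] by (auto simp: decision_eq Let_def)
qed

lemma computed_nonterminal: "phase (computed j) \<noteq> Terminate"
  using decision_nonterminal lineD(2) by (simp add: computed_def)

lemma computed_turning: "j \<in> turning \<Longrightarrow> computed j = turn (mem (c j))"
  using decision_nonterminal[of j]
  by (auto simp: computed_def turning_def decision_eq Let_def split: if_splits)

lemma computed_not_turning:
  "j \<notin> turning \<Longrightarrow> computed j = mem (c j) \<or> computed j = meets_anew (mem (c j))"
  using decision_nonterminal[of j]
  by (auto simp: computed_def turning_def decision_eq Let_def split: if_splits)

lemma seen_computed: "seen (computed j) = seen (mem (c j))" "offset (computed j) = offset (mem (c j))"
  using computed_turning[of j] computed_not_turning[of j] by (cases "j \<in> turning"; auto)+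

lemma next_not_moving:
  assumes "\<not> moves j"
  shows "node (next_conf j) = node (c j)" "mem (next_conf j) = computed j"
    "place (c j) \<noteq> InNode \<Longrightarrow> place (next_conf j) \<noteq> InNode"
  using assms by (cases rule: round_cases[of j]; simp)+

lemma next_moving:
  assumes "moves j" "node (next_conf j) \<noteq> x"
  shows "line_pos n x (node (next_conf j)) = pos j + sign (l j) (dir (computed j))"
    "mem (next_conf j) = record_move (dir (computed j)) (computed j)"
    "place (next_conf j) = InNode"
proof -
  obtain s where s: "s = side_of (l j) (dir (computed j))"
    "next_conf j = \<lparr>node = neighbour n (node (c j)) s, place = InNode,
         mem = record_move (dir (computed j)) (computed j)\<rparr>"
    by (cases rule: round_cases[of j]) (use assms(1) in auto)
  then show "mem (next_conf j) = record_move (dir (computed j)) (computed j)"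
    "place (next_conf j) = InNode" by simp_all
  have "line_pos n x (neighbour n (node (c j)) s) = pos j + side_sign s"
    using assms(2) s(2) line_pos_neighbour[OF node_less x lineD(1)] by simp
  then show "line_pos n x (node (next_conf j)) = pos j + sign (l j) (dir (computed j))"
    using s by (simp add: sign_def)
qed

lemma dir_next:
  assumes "node (next_conf j) \<noteq> x"
  shows "dir (mem (next_conf j)) = dir (computed j)" "phase (mem (next_conf j)) = phase (computed j)"
    "dist (mem (next_conf j)) = dist (computed j)"
  using next_not_moving[of j] next_moving[of j] assms by (cases "moves j"; simp)+

lemma on_line_next:
  assumes unvisited: "\<And>j. node (next_conf j) \<noteq> x"
  shows "on_line n N x l next_conf"
proof -
  let ?pos' = "\<lambda>j. line_pos n x (node (next_conf j))"
  have "?pos' j + sign (l j) Rgt * (i - offset (mem (next_conf j))) \<in> {1..int n - 1}"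
    if i: "i \<in> seen (mem (next_conf j))" for i j
  proof (cases "moves j")
    case False
    then show ?thesis using lineD(4)[of i j] i by (simp add: next_not_moving seen_computed)
  next
    case True
    note nm = next_moving[OF True unvisited]
    let ?\<delta> = "dir (computed j)"
    have off: "offset (mem (next_conf j)) = offset (mem (c j)) + displacement ?\<delta>"
      by (simp add: nm(2) seen_computed)
    \<comment> \<open>Position and offset shift together, so a known offset keeps its line
      position.\<close>
    have eq: "?pos' j + sign (l j) Rgt * (i - offset (mem (next_conf j)))
        = pos j + sign (l j) Rgt * (i - offset (mem (c j)))"
      using nm(1) sign_displacement[of j ?\<delta>] unfolding off by (simp add: algebra_simps)
    show ?thesis
    proof (cases "i \<in> seen (mem (c j))")
      case True
      then show ?thesis unfolding eq by (rule lineD(4))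
    next
      case False
      then have "i = offset (mem (next_conf j))" using i nm(2) by (simp add: seen_computed)
      moreover have "node (next_conf j) < n"
        using ports_ok_next by (simp add: ports_ok_def)
      ultimately show ?thesis using line_pos_bounds[OF _ x unvisited] by simp
    qed
  qed
  moreover have "diverging ?pos' (\<lambda>j. sign (l j) (dir (mem (next_conf j))))
       (\<lambda>j. place (next_conf j) \<noteq> InNode) (\<lambda>j. esteps (mem (next_conf j)))
       (\<lambda>j. dist (mem (next_conf j))) (\<lambda>j. phase (mem (next_conf j)) \<noteq> Init)
       (\<lambda>j. phase (mem (next_conf j)) \<in> {Bounce, Reverse})"
  proof (rule diverging_round[OF diverging, where T = turning and M = "{j. moves j}"])
    fix j
    show "sgn_dir j = 1 \<or> sgn_dir j = -1" by (rule sign_cases)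
  next
    fix j assume j: "j \<in> turning"
    then have catch: "catching c j (side_of (l j) (dir (mem (c j))))" by (simp add: turning_def)
    note turned = computed_turning[OF j]
    have "place (c j) = InNode" using catch by (simp add: catching_def)
    moreover have "sign (l j) (dir (mem (next_conf j))) = - sgn_dir j"
      using computed_nonterminal[of j] dir_turn[of "mem (c j)"]
      by (simp add: dir_next[OF unvisited] turned sign_opposite)
    moreover have "dist (mem (next_conf j)) = 0 \<or>
        phase (mem (c j)) \<noteq> Init \<and> dist (mem (next_conf j)) = esteps (mem (c j))"
    proof -
      \<comment> \<open>An agent in Init heads left with \<open>dist\<close> zero, so its first turn
        leaves \<open>dist\<close> zero; a positive \<open>dist\<close> thus comes from an agent
        that had turned before.\<close>
      have "dist (mem (c j)) = 0 \<and> dir (mem (c j)) = Lft" if "phase (mem (c j)) = Init"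
        using that lineD(3)[of j] by (auto simp: memory_ok_def dir_def heading_def)
      then show ?thesis
        using computed_nonterminal[of j] dist_turn(2)[of "mem (c j)"]
        by (auto simp: dir_next[OF unvisited] turned)
    qed
    moreover obtain k where "k \<noteq> j" "pos k = pos j" "sgn_dir k = sgn_dir j" "place (c k) \<noteq> InNode"
      using caught[OF catch] by blast
    ultimately show "\<not> place (c j) \<noteq> InNode \<and> sign (l j) (dir (mem (next_conf j))) = - sgn_dir j \<and>
        (dist (mem (next_conf j)) = 0 \<or>
         phase (mem (c j)) \<noteq> Init \<and> dist (mem (next_conf j)) = esteps (mem (c j))) \<and>
        (\<exists>k. k \<noteq> j \<and> pos k = pos j \<and> sgn_dir k = sgn_dir j \<and> place (c k) \<noteq> InNode)"
      by blast
  next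
    fix j assume "j \<notin> turning"
    then have "computed j = mem (c j) \<or> computed j = meets_anew (mem (c j))"
      by (rule computed_not_turning)
    then show "sign (l j) (dir (mem (next_conf j))) = sgn_dir j \<and>
        dist (mem (next_conf j)) = dist (mem (c j)) \<and>
        (phase (mem (next_conf j)) \<noteq> Init \<longrightarrow> phase (mem (c j)) \<noteq> Init) \<and>
        (phase (mem (next_conf j)) \<in> {Bounce, Reverse} \<longrightarrow> phase (mem (c j)) \<in> {Bounce, Reverse})"
      by (auto simp: dir_next[OF unvisited]) (auto simp: meets_anew_def split: if_splits)
  next
    fix j assume "j \<in> {j. moves j}"
    then have "moves j" by simp
    then show "?pos' j = pos j + sign (l j) (dir (mem (next_conf j))) \<and>
        esteps (mem (next_conf j)) = Suc (if j \<in> turning then 0 else esteps (mem (c j))) \<and>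
        \<not> place (next_conf j) \<noteq> InNode"
      using next_moving[OF _ unvisited] computed_turning[of j] computed_not_turning[of j]
      by (auto simp: dir_next[OF unvisited])
  next
    fix j assume "j \<notin> {j. moves j}"
    then have "\<not> moves j" by simp
    then show "?pos' j = pos j \<and>
        esteps (mem (next_conf j)) = (if j \<in> turning then 0 else esteps (mem (c j))) \<and>
        (place (c j) \<noteq> InNode \<longrightarrow> place (next_conf j) \<noteq> InNode)"
      using next_not_moving computed_turning[of j] computed_not_turning[of j] by auto
  next
    fix i j assume "place (c i) \<noteq> InNode" "place (c j) \<noteq> InNode" "sgn_dir i = 1" "sgn_dir j = -1"
    then obtain s s' where s: "place (c i) = OnPort s" "place (c j) = OnPort s'"
      by (meson place.exhaust)
    have "s = Plus" "s' = Minus"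
      using on_portD(3)[OF s(1)] on_portD(3)[OF s(2)] \<open>sgn_dir i = 1\<close> \<open>sgn_dir j = -1\<close>
      by (cases s; cases s'; simp add: sign_def)+
    then show "pos j = pos i + 1"
      using one_edge[OF s] line_pos_edge[OF node_less node_less x lineD(1) lineD(1)] by simp
  next
    fix j assume j: "j \<in> turning" "j \<notin> {j. moves j}" "\<not> place (next_conf j) \<noteq> InNode"
    \<comment> \<open>The agent turned but got no port, so a competitor \<open>k\<close> from inside
      the node gained it; asking for the same side means the same sign.\<close>
    have A: "j \<in> A" "place (c j) = InNode" using j(1) by (auto simp: turning_def catching_def)
    have pj: "p j = InNode" by (cases rule: round_cases[of j]) (use j in auto)
    obtain k where k: "k \<in> A" "node (c k) = node (c j)" "place (c k) = InNode"
      "p k = OnPort (side_of (l j) (dir (decision N l c j)))"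
      "side_of (l k) (dir (decision N l c k)) = side_of (l j) (dir (decision N l c j))"
      using port_gained[OF A decision_nonterminal] by blast
    have "k \<noteq> j" using pj k(4) by auto
    moreover have "sign (l k) (dir (mem (next_conf k))) = sign (l j) (dir (mem (next_conf j)))"
      using k(1,5) A by (simp add: dir_next[OF unvisited] sign_def computed_def)
    moreover have "moves k \<or> place (next_conf k) \<noteq> InNode"
      by (cases rule: round_cases[of k]) (use k(4) in auto)
    ultimately show "\<exists>k. k \<noteq> j \<and> pos k = pos j \<and> \<not> place (c k) \<noteq> InNode \<and>
        sign (l k) (dir (mem (next_conf k))) = sign (l j) (dir (mem (next_conf j))) \<and>
        (k \<in> {j. moves j} \<or> place (next_conf k) \<noteq> InNode)"
      using k(2,3) by (intro exI[of _ k]) simp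
  qed
  ultimately show ?thesis
    unfolding on_line_def
    using unvisited computed_nonterminal memory_ok_next(1)[OF lineD(3)] by (simp add: dir_next)
qed

end

subsection \<open>Executions\<close>

lemma potential_initial: "initial_agent n a \<Longrightarrow> potential N (mem a) = 0"
  by (simp add: initial_agent_def potential_def dir_def heading_def)

lemma memory_ok_initial: "initial_agent n a \<Longrightarrow> 0 < N \<Longrightarrow> memory_ok N (mem a)"
  unfolding memory_ok_def
  by (intro exI[of _ 0]) (simp add: initial_agent_def dir_def heading_def)

locale pt_run =
  fixes n N :: nat and E :: "3 execution"
  assumes n_ge: "2 \<le> n" and N_ge: "n \<le> N" and exec: "pt_execution n N E"
begin

abbreviation "after t \<equiv> next_configuration n N (orient E) (active E t) (missing E t) (config E t) (access E t)"

abbreviation "moving t j \<equiv>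
  \<exists>s. traverses n N (orient E) (active E t) (missing E t) (config E t) (access E t) j s"

lemma config_Suc: "config E (Suc t) = after t"
  using exec by (simp add: pt_execution_def)

lemma initial: "initial_agent n (config E 0 j)"
  using exec by (simp add: pt_execution_def)

lemma ports_ok_config: "ports_ok n N (orient E) (config E t)"
proof (induction t)
  case 0
  show ?case using initial by (simp add: ports_ok_def initial_agent_def)
next
  case (Suc t)
  interpret pt_round n N "orient E" "active E t" "missing E t" "config E t" "access E t"
    using exec Suc n_ge by unfold_locales (auto simp: pt_execution_def)
  show ?case unfolding config_Suc by (rule ports_ok_next)
qed

sublocale round: pt_round n N "orient E" "active E t" "missing E t" "config E t" "access E t" for t
  using exec ports_ok_config n_ge by unfold_locales (auto simp: pt_execution_def)

lemma memory_ok_config: "memory_ok N (mem (config E t j))"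
proof (induction t)
  case 0
  show ?case using memory_ok_initial[OF initial] n_ge N_ge by simp
next
  case (Suc t)
  then show ?case unfolding config_Suc by (rule round.memory_ok_next(1))
qed

section \<open>Cost and quiescence\<close>

lemma traversals_Suc: "traversals n N E (Suc T) = traversals n N E T + card {j. moving T j}"
proof -
  let ?S = "\<lambda>T. {(t, j). t < T \<and> moving t j}"
  have "?S (Suc T) = ?S T \<union> {T} \<times> {j. moving T j}" by (auto simp: less_Suc_eq)
  moreover have "?S T \<inter> {T} \<times> {j. moving T j} = {}" by auto
  moreover have "finite (?S T)"
    by (rule finite_subset[of _ "{..<T} \<times> UNIV"]) auto
  ultimately have "card (?S (Suc T)) = card (?S T) + card ({T} \<times> {j. moving T j})"
    by (simp add: card_Un_disjoint)
  then show ?thesis by (simp add: traversals_def card_cartesian_product)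
qed

lemma traversals_potential: "int (traversals n N E T) \<le> (\<Sum>j\<in>UNIV. potential N (mem (config E T j)))"
proof (induction T)
  case 0
  show ?case using potential_initial[OF initial] by (simp add: traversals_def)
next
  case (Suc T)
  have "int (card {j. moving T j}) = (\<Sum>j\<in>UNIV. if moving T j then 1 else 0)"
    by (simp add: sum.If_cases)
  then have "int (traversals n N E (Suc T)) \<le>
      (\<Sum>j\<in>UNIV. potential N (mem (config E T j)) + (if moving T j then 1 else 0))"
    using Suc by (simp add: traversals_Suc sum.distrib)
  also have "\<dots> \<le> (\<Sum>j\<in>UNIV. potential N (mem (config E (Suc T) j)))"
    unfolding config_Suc by (intro sum_mono round.memory_ok_next(2) memory_ok_config)
  finally show ?case .
qed

lemma traversals_le: "traversals n N E T \<le> 3 * (N * N + N)"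
proof -
  have "(\<Sum>j\<in>(UNIV :: 3 set). potential N (mem (config E T j))) \<le> (\<Sum>j\<in>(UNIV :: 3 set). int (N * N + N))"
    by (intro sum_mono potential_le memory_ok_config)
  also have "\<dots> = int (3 * (N * N + N))" by simp
  finally show ?thesis using traversals_potential[of T] by linarith
qed

lemma eventually_quiescent:
  obtains T where "\<And>t j. T \<le> t \<Longrightarrow> \<not> moving t j"
    "\<And>t j. T \<le> t \<Longrightarrow> node (config E t j) = node (config E T j)"
    "\<And>t j. T \<le> t \<Longrightarrow> place (config E t j) = place (config E T j)"
proof -
  \<comment> \<open>The bounded number of traversals attains its maximum, after which nobody
    moves.\<close>
  have "\<exists>T0. True \<and> (\<forall>t. True \<longrightarrow> traversals n N E t \<le> traversals n N E T0)"
    by (rule ex_has_greatest_nat[where b = "Suc (3 * (N * N + N))"])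
       (use traversals_le le_imp_less_Suc in blast)+
  then obtain T0 where T0: "\<And>t. traversals n N E t \<le> traversals n N E T0" by blast
  have mono: "traversals n N E t \<le> traversals n N E t'" if "t \<le> t'" for t t'
    using that by (rule lift_Suc_mono_le[rotated]) (simp add: traversals_Suc)
  have still: "\<not> moving t j" if "T0 \<le> t" for t j
  proof
    assume "moving t j"
    then have "{j. moving t j} \<noteq> {}" by auto
    then have "0 < card {j. moving t j}" by (simp add: card_gt_0_iff)
    then show False using T0[of "Suc t"] mono[OF that] by (simp add: traversals_Suc)
  qed
  let ?W = "\<lambda>t. {j. place (config E t j) \<noteq> InNode}"
  \<comment> \<open>Without traversals nobody leaves a port, so the set of waiting agents only
    grows; from a round of maximal size on it is constant.\<close>
  have "\<exists>T1. T0 \<le> T1 \<and> (\<forall>t. T0 \<le> t \<longrightarrow> card (?W t) \<le> card (?W T1))"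
    by (rule ex_has_greatest_nat[where b = 3 and k = T0]) (use round.card_waiting in \<open>auto simp: le_imp_less_Suc numeral_3_eq_3 numeral_2_eq_2\<close>)
  then obtain T1 where T1: "T0 \<le> T1" "\<And>t. T0 \<le> t \<Longrightarrow> card (?W t) \<le> card (?W T1)" by blast
  have wait_step: "place (config E (Suc t) j) = OnPort s"
    if "T0 \<le> t" "place (config E t j) = OnPort s" for t j s
    using round.next_waiting[OF that(2) still[OF that(1)]] by (simp add: config_Suc)
  have grow: "?W T1 \<subseteq> ?W t" if "T1 \<le> t" for t
    using that
  proof (induction t rule: dec_induct)
    case (step t)
    have "?W t \<subseteq> ?W (Suc t)"
    proof
      fix j assume "j \<in> ?W t"
      then obtain s where "place (config E t j) = OnPort s" by (cases "place (config E t j)") auto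
      then show "j \<in> ?W (Suc t)" using wait_step[of t j s] step T1(1) by simp
    qed
    then show ?case using step by blast
  qed simp
  have W: "?W t = ?W T1" if "T1 \<le> t" for t
    using card_seteq[OF finite grow[OF that] T1(2)[OF order.trans[OF T1(1) that]]] by simp
  have "node (config E t j) = node (config E T1 j) \<and> place (config E t j) = place (config E T1 j)"
    if "T1 \<le> t" for t j
    using that
  proof (induction t rule: dec_induct)
    case (step t)
    have "place (config E (Suc t) j) = place (config E t j)"
    proof (cases "place (config E t j)")
      case InNode
      then have "j \<notin> ?W t" by simp
      then have "j \<notin> ?W (Suc t)" using W[of t] W[of "Suc t"] step by simp
      then show ?thesis using InNode by simp
    next
      case (OnPort s)
      then show ?thesis using wait_step[of t j s] step T1(1) by simp
    qed
    moreover have "node (config E (Suc t) j) = node (config E t j)"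
      using still T1(1) step unfolding config_Suc by (intro round.next_node) simp
    ultimately show ?case using step by simp
  qed simp
  then show ?thesis
    using that[of T1] still[OF order.trans[OF T1(1)]] by blast
qed

section \<open>Termination only after exploration, and the final state\<close>

lemma on_line_config:
  assumes "x < n" "\<And>s j. s \<le> t \<Longrightarrow> node (config E s j) \<noteq> x"
  shows "on_line n N x (orient E) (config E t)"
  using assms(2)
proof (induction t)
  case 0
  have "1 \<le> line_pos n x (node (config E 0 j))" "line_pos n x (node (config E 0 j)) \<le> int n - 1" for j
    using line_pos_bounds[OF round.node_less[of 0 j] assms(1)] 0 by simp_all
  \<comment> \<open>Initially the clauses of \<open>diverging\<close> are vacuous:
    \<open>dist\<close> is zero and every agent is in Init, neither turned nor fresh.\<close>
  then show ?case
    using initial memory_ok_config[of 0] 0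
    by (simp add: on_line_def diverging_def initial_agent_def)
next
  case (Suc t)
  interpret line_round n N "orient E" "active E t" "missing E t" "config E t" "access E t" x
    using Suc assms(1) N_ge by unfold_locales auto
  show ?case unfolding config_Suc
    by (rule on_line_next) (use Suc.prems[of "Suc t"] in \<open>simp add: config_Suc\<close>)
qed

lemma explored_if_decided:
  assumes "phase (decision N (orient E) (config E t) j) = Terminate"
  shows "explored_by n E t"
proof (rule ccontr)
  assume "\<not> explored_by n E t"
  then obtain x where x: "x < n" "\<And>s j. s \<le> t \<Longrightarrow> node (config E s j) \<noteq> x"
    by (auto simp: explored_by_def)
  interpret line_round n N "orient E" "active E t" "missing E t" "config E t" "access E t" x
    using on_line_config[OF x] x(1) N_ge by unfold_locales auto
  show False using decision_nonterminal[of j] assms by simp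
qed

lemma explicitly_terminates_if_terminated:
  assumes "terminated E j T"
  shows "explicitly_terminates n E j"
proof -
  \<comment> \<open>The first terminated configuration is \<open>t' = Suc t\<close>; the terminal
    decision falls in round \<open>t\<close>, and exploration must be complete by that
    index.\<close>
  define t' where "t' = (LEAST t. terminated E j t)"
  have t': "terminated E j t'" "\<And>t. t < t' \<Longrightarrow> \<not> terminated E j t"
    using assms unfolding t'_def by (auto intro: LeastI dest: not_less_Least)
  then obtain t where t: "t' = Suc t"
    using initial[of j] by (cases t') (auto simp: terminated_def initial_agent_def)
  have nt: "phase (mem (config E t j)) \<noteq> Terminate" and te: "phase (mem (after t j)) = Terminate"
    using t' t by (auto simp: terminated_def config_Suc)
  note * = round.terminates_next[OF nt te]
  have "config E s j = config E (Suc t) j" if "Suc t \<le> s" for s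
    using that
  proof (induction s rule: dec_induct)
    case (step s)
    then have "phase (mem (config E s j)) = Terminate" using te by (simp add: config_Suc)
    then show ?case using round.terminated_next step by (simp add: config_Suc)
  qed simp
  then have "\<forall>s>t. terminated E j s \<and> same_position E j t s"
    using * te by (auto simp: terminated_def same_position_def config_Suc Suc_le_eq)
  then show ?thesis
    unfolding explicitly_terminates_def
    using explored_if_decided[OF *(3)] nt by (auto simp: terminated_def)
qed

lemma final_state:
  obtains j where "explicitly_terminates n E j"
    "\<And>k. explicitly_terminates n E k \<or> waits_perpetually_on_port E k"
proof -
  obtain T where T: "\<And>t j. T \<le> t \<Longrightarrow> \<not> moving t j"
    "\<And>t j. T \<le> t \<Longrightarrow> node (config E t j) = node (config E T j)"
    "\<And>t j. T \<le> t \<Longrightarrow> place (config E t j) = place (config E T j)"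
    using eventually_quiescent by blast
  have in_node: "explicitly_terminates n E j" if j: "place (config E T j) = InNode" for j
  proof -
    obtain t where t: "T \<le> t" "j \<in> active E t"
      using exec unfolding pt_execution_def by blast
    have pl: "place (config E t j) = InNode" using T(3)[OF t(1)] j by simp
    \<comment> \<open>Otherwise some agent in the node would gain the free port and either traverse
      the edge or stay on the port, although nothing changes any more.\<close>
    have dec: "phase (decision N (orient E) (config E t) j) = Terminate"
    proof (rule ccontr)
      assume "\<not> ?thesis"
      then obtain k s where k: "place (config E t k) = InNode" "access E t k = OnPort s"
        using round.port_gained[OF t(2) pl] by blast
      have "place (config E (Suc t) k) \<noteq> InNode"
        unfolding config_Suc using k(2) T(1)[OF t(1), of k]
        by (cases rule: round.round_cases[of t k]) simp_all
      then show False using k(1) T(3)[of t k] T(3)[of "Suc t" k] t(1) by simp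
    qed
    have "phase (mem (after t j)) = Terminate"
      by (cases rule: round.round_cases[of t j]) (use dec t(2) in \<open>simp_all add: round.computed_def\<close>)
    then have "terminated E j (Suc t)" by (simp add: terminated_def config_Suc)
    then show ?thesis by (rule explicitly_terminates_if_terminated)
  qed
  have on_port: "waits_perpetually_on_port E j" if "place (config E T j) = OnPort s" for j s
    unfolding waits_perpetually_on_port_def
  proof (intro exI allI impI)
    fix t assume t: "T \<le> t"
    then have "place (config E t j) = OnPort s" using T(3)[OF t, of j] that by simp
    then show "\<not> terminated E j t \<and> place (config E t j) = OnPort s \<and> same_position E j T t"
      using round.on_portD(1)[of t j s] T(2,3)[OF t, of j]
      by (simp add: terminated_def same_position_def)
  qed
  have "{j. place (config E T j) \<noteq> InNode} \<noteq> UNIV"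
  proof
    assume "{j. place (config E T j) \<noteq> InNode} = UNIV"
    then show False using round.card_waiting[of T] by simp
  qed
  then obtain j where "place (config E T j) = InNode" by blast
  moreover have "explicitly_terminates n E k \<or> waits_perpetually_on_port E k" for k
    using in_node[of k] on_port[of k] by (cases "place (config E T k)") auto
  ultimately show ?thesis using that in_node by blast
qed

end

theorem theorem16:
  shows "\<exists>f :: nat \<Rightarrow> real. f \<in> O(\<lambda>N. real N ^ 2) \<and>
    (\<forall>(n :: nat) (N :: nat) (E :: 3 execution).
       2 \<le> n \<longrightarrow> n \<le> N \<longrightarrow> pt_execution n N E \<longrightarrow>
         solves_exploration n E \<and>
         (\<forall>T. real (traversals n N E T) \<le> f N) \<and>
         (\<exists>j. explicitly_terminates n E j \<and>
            (\<forall>k. k \<noteq> j \<longrightarrow> explicitly_terminates n E k \<or> waits_perpetually_on_port E k)))"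
proof (intro exI[of _ "\<lambda>N. real (3 * (N * N + N))"] conjI allI impI)
  show "(\<lambda>N. real (3 * (N * N + N))) \<in> O(\<lambda>N. real N ^ 2)"
  \<comment> \<open>Since \<open>N \<le> N * N\<close> for every natural number, the constant 6
    works without a threshold.\<close>
  proof (rule bigoI[where c = 6], rule always_eventually, rule allI)
    fix N :: nat
    have "N \<le> N * N" by (cases N) auto
    then have "real N \<le> real N * real N" by (metis of_nat_le_iff of_nat_mult)
    then show "norm (real (3 * (N * N + N))) \<le> 6 * norm (real N ^ 2)"
      by (simp add: power2_eq_square)
  qed
next
  fix n N :: nat and E :: "3 execution"
  assume "2 \<le> n" "n \<le> N" "pt_execution n N E"
  then interpret pt_run n N E by unfold_locales
  obtain j where j: "explicitly_terminates n E j"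
    "\<And>k. explicitly_terminates n E k \<or> waits_perpetually_on_port E k"
    by (rule final_state) blast
  then show "solves_exploration n E"
    by (auto simp: explicitly_terminates_def solves_exploration_def)
  show "real (traversals n N E T) \<le> real (3 * (N * N + N))" for T
    using traversals_le by (rule of_nat_mono)
  show "\<exists>j. explicitly_terminates n E j \<and>
      (\<forall>k. k \<noteq> j \<longrightarrow> explicitly_terminates n E k \<or> waits_perpetually_on_port E k)"
    using j by blast
qed

end
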